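(* For $p\in[0,1]$, \[ \lim_{n\to\infty} T_n(p) = \begin{cases} 0 & \text{if } p<p_c,\\ 1 & \text{if } p>p_c.\end{cases} \]
   Context: A dyadic tile of order $n\ge 0$ is a rectangle of the form $\bigl[\frac{a}{2^i},\frac{a+1}{2^i}\bigr]\times\bigl[\frac{b}{2^j},\frac{b+1}{2^j}\bigr]$, where $a,b,i,j\ge 0$ are integers with $i+j=n$, $a<2^i$ and $b<2^j$ (so that the tile is a subset of $[0,1]^2$). A tiling of a rectangle $R$ is a set of tiles whose union is $R$ and whose interiors are pairwise disjoint. For $p\in[0,1]$, each of the $(n+1)2^n$ tiles of order $n$ is available with probability $p$, independently of the others. $T_n(p)$ denotes the probability that there exists a set of available order-$n$ tiles that is a tiling of the unit square $[0,1]^2$. The critical probability is $p_c:=\inf\{p\in[0,1]:\lim_{n\to\infty}T_n(p)=1\}$. *)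

theory Defs
  imports "HOL-Analysis.Analysis" "HOL-Probability.Probability"
begin

definition dyadic_tile :: "nat \<Rightarrow> nat \<Rightarrow> nat \<Rightarrow> nat \<Rightarrow> (real \<times> real) set" where
  "dyadic_tile i j a b =
     {real a / 2 ^ i .. (real a + 1) / 2 ^ i} \<times> {real b / 2 ^ j .. (real b + 1) / 2 ^ j}"

definition dyadic_tiles :: "nat \<Rightarrow> (real \<times> real) set set" where
  "dyadic_tiles n = {dyadic_tile i j a b | i j a b. i + j = n \<and> a < 2 ^ i \<and> b < 2 ^ j}"

definition is_tiling :: "(real \<times> real) set set \<Rightarrow> (real \<times> real) set \<Rightarrow> bool" where
  "is_tiling S R \<longleftrightarrow> \<Union>S = R \<and> pairwise (\<lambda>s t. interior s \<inter> interior t = {}) S"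

definition unit_square :: "(real \<times> real) set" where
  "unit_square = {0..1} \<times> {0..1}"

text \<open>The set of tiles is finite, so the product distribution below is the intended one, and
  tiles with different parameters are different sets, so there are $(n+1)2^n$ independent choices.\<close>

lemma dyadic_tiles_eq_image:
  "dyadic_tiles n =
     (\<lambda>(i, a, b). dyadic_tile i (n - i) a b) ` (SIGMA i:{..n}. {..<2 ^ i} \<times> {..<2 ^ (n - i)})"
  by (force simp: dyadic_tiles_def image_iff)

lemma finite_dyadic_tiles: "finite (dyadic_tiles n)"
  unfolding dyadic_tiles_eq_image by (intro finite_imageI finite_SigmaI) auto

lemma dyadic_tile_inject:
  assumes "dyadic_tile i j a b = dyadic_tile i' j' a' b'"
  shows "i = i' \<and> j = j' \<and> a = a' \<and> b = b'"
proof -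
  have ne: "real c / 2 ^ k \<le> (real c + 1) / 2 ^ k" for c k :: nat
    by (simp add: divide_right_mono)
  have inj: "k = k' \<and> c = c'"
    if eq: "{real c / 2 ^ k .. (real c + 1) / 2 ^ k} = {real c' / 2 ^ k' .. (real c' + 1) / 2 ^ k'}"
    for c k c' k' :: nat
  proof -
    have l: "real c / 2 ^ k = real c' / 2 ^ k'"
      and r: "(real c + 1) / 2 ^ k = (real c' + 1) / 2 ^ k'"
      using eq ne[of c k] by (simp_all add: Icc_eq_Icc)
    have "1 / (2::real) ^ k = 1 / 2 ^ k'"
      using l r by (simp add: add_divide_distrib)
    then have "k = k'" by simp
    with l show ?thesis by simp
  qed
  have "{real a / 2 ^ i .. (real a + 1) / 2 ^ i} = {real a' / 2 ^ i' .. (real a' + 1) / 2 ^ i'}"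
    "{real b / 2 ^ j .. (real b + 1) / 2 ^ j} = {real b' / 2 ^ j' .. (real b' + 1) / 2 ^ j'}"
    using assms ne[of a i] ne[of b j] unfolding dyadic_tile_def by (auto simp: times_eq_iff)
  then show ?thesis using inj by blast
qed

lemma card_dyadic_tiles: "card (dyadic_tiles n) = (n + 1) * 2 ^ n"
proof -
  have "card (dyadic_tiles n) = card (SIGMA i:{..n}. {..<(2::nat) ^ i} \<times> {..<(2::nat) ^ (n - i)})"
    unfolding dyadic_tiles_eq_image
    by (rule card_image) (auto simp: inj_on_def dest: dyadic_tile_inject)
  also have "\<dots> = (\<Sum>i\<le>n. 2 ^ i * 2 ^ (n - i))"
    by (subst card_SigmaI) (auto simp: card_cartesian_product)
  also have "\<dots> = (\<Sum>i\<le>n. 2 ^ n)"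
    by (intro sum.cong) (simp_all flip: power_add)
  finally show ?thesis by simp
qed

text \<open>A configuration \<open>\<omega>\<close> says which tiles of order \<open>n\<close> are available; outside
  \<^term>\<open>dyadic_tiles n\<close> it is constantly \<^term>\<open>False\<close>.\<close>

definition availability :: "nat \<Rightarrow> real \<Rightarrow> ((real \<times> real) set \<Rightarrow> bool) pmf" where
  "availability n p = Pi_pmf (dyadic_tiles n) False (\<lambda>_. bernoulli_pmf p)"

definition tiling_prob :: "nat \<Rightarrow> real \<Rightarrow> real" where
  "tiling_prob n p = measure_pmf.prob (availability n p)
     {\<omega>. \<exists>S \<subseteq> {t \<in> dyadic_tiles n. \<omega> t}. is_tiling S unit_square}"

definition crit_prob :: real where
  "crit_prob = Inf {p \<in> {0..1}. (\<lambda>n. tiling_prob n p) \<longlonglongrightarrow> 1}"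

end

theory Submission
  imports Defs "HOL-Real_Asymp.Real_Asymp"
begin

text \<open>
  Write \<open>T\<^sub>n(p)\<close> for the probability that the unit square can be tiled by available tiles of order
  \<open>n\<close>. Two facts imply the theorem.

  First, \<open>T\<^sub>n\<^sub>+\<^sub>1 \<le> 2 T\<^sub>n\<^sup>2\<close> (\<open>tiling_prob_Suc_le\<close>). Every tiling respects the
  vertical or the horizontal bisector of the square, since a tile of full width and a tile of full
  height overlap; and the problems in the two halves are independent copies of the problem of order
  \<open>n\<close>. Consequently \<open>T\<^sub>n(p)\<close> tends to \<open>0\<close> as soon as it is below one half for a single \<open>n\<close>.

  Second, if \<open>T\<^sub>n(p) \<ge> 1/2\<close> for all \<open>n\<close>, then \<open>T\<^sub>n(p')\<close> tends to \<open>1\<close> for every \<open>p' > p\<close>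
  (\<open>tiling_prob_tendsto_1\<close>). This is a sharp threshold phenomenon. By the Margulis--Russo formula
  (\<open>russo_formula\<close>) the derivative of \<open>T\<^sub>n\<close> is the total influence, the sum over all tiles of the
  probability that the tile is pivotal. Somewhere in the interval from \<open>p\<close> to \<open>p'\<close> it is at most
  \<open>K = 1 / (p' - p)\<close>. Flipping binary digits of the coordinates gives a group of symmetries that
  permutes the \<open>2\<^sup>n\<close> tiles of each shape transitively, so that each single influence there is at
  most \<open>K / 2\<^sup>n\<close> (\<open>tileable_influence_le\<close>). On the other hand, the variance times
  \<open>ln (1 / \<delta>)\<close> is at most twice the total influence when no influence exceeds \<open>\<delta>\<close>
  (\<open>variance_ln_influence_le\<close>, following Falik and Samorodnitsky, and based on a logarithmic Sobolev
  inequality). Hence \<open>T\<^sub>n (1 - T\<^sub>n)\<close> is of order \<open>1 / n\<close> at that point, and \<open>T\<^sub>n\<close> is close to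
  \<open>1\<close> from there on.

  Thus failure of convergence to \<open>0\<close> at some \<open>p\<close> below the critical value would force convergence to
  \<open>1\<close> strictly below it, against its definition; above it, convergence to \<open>1\<close> is
  inherited by monotonicity in \<open>p\<close>.
\<close>

section \<open>Means over a product of Bernoulli trials\<close>

text \<open>The mean of \<open>f\<close> over a random subset of \<open>V\<close> in which each element is present
  independently with probability \<open>q\<close>. An explicit polynomial in \<open>q\<close> is the convenient form:
  it can be differentiated in \<open>q\<close>, and conditioning on one element gives a recursion on \<open>V\<close>
  by which most facts below are proved.\<close>

definition bmean :: "real \<Rightarrow> 'a set \<Rightarrow> ('a set \<Rightarrow> real) \<Rightarrow> real" where
  "bmean q V f = (\<Sum>S\<in>Pow V. q ^ card S * (1 - q) ^ card (V - S) * f S)"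

text \<open>For a monotone indicator \<open>f\<close> this is the indicator that \<open>v\<close> is pivotal, and its mean is
  the influence of \<open>v\<close>. The value does not depend on whether \<open>v \<in> S\<close>.\<close>

definition flip_diff :: "('a set \<Rightarrow> real) \<Rightarrow> 'a \<Rightarrow> 'a set \<Rightarrow> real" where
  "flip_diff f v S = f (insert v S) - f (S - {v})"

lemma bmean_empty [simp]: "bmean q {} f = f {}"
  by (simp add: bmean_def)

text \<open>Conditioning on the presence of \<open>v\<close>.\<close>

lemma bmean_insert:
  assumes "finite V" "v \<notin> V"
  shows "bmean q (insert v V) f = q * bmean q V (\<lambda>S. f (insert v S)) + (1 - q) * bmean q V f"
proof -
  let ?w = "\<lambda>S. q ^ card S * (1 - q) ^ card (insert v V - S) * f S"
  have "bmean q (insert v V) f = sum ?w (Pow V) + sum ?w (insert v ` Pow V)"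
    unfolding bmean_def Pow_insert using assms by (intro sum.union_disjoint) auto
  moreover have "sum ?w (Pow V) = (1 - q) * bmean q V f"
    unfolding bmean_def sum_distrib_left
  proof (intro sum.cong refl)
    fix S assume "S \<in> Pow V"
    then have "insert v V - S = insert v (V - S)" "v \<notin> V - S" "finite (V - S)"
      using assms by auto
    then show "?w S = (1 - q) * (q ^ card S * (1 - q) ^ card (V - S) * f S)"
      by (simp add: mult_ac)
  qed
  moreover have "sum ?w (insert v ` Pow V) = (\<Sum>S\<in>Pow V. ?w (insert v S))"
    using assms by (subst sum.reindex) (auto simp: inj_on_def)
  moreover have "\<dots> = q * bmean q V (\<lambda>S. f (insert v S))"
    unfolding bmean_def sum_distrib_left
  proof (intro sum.cong refl)
    fix S assume "S \<in> Pow V"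
    then have "insert v V - insert v S = V - S" "v \<notin> S" "finite S"
      using assms by (auto intro: finite_subset)
    then show "?w (insert v S) = q * (q ^ card S * (1 - q) ^ card (V - S) * f (insert v S))"
      by (simp add: mult_ac)
  qed
  ultimately show ?thesis by simp
qed

lemma bmean_cong:
  assumes "\<And>S. S \<subseteq> V \<Longrightarrow> f S = g S"
  shows "bmean q V f = bmean q V g"
  unfolding bmean_def using assms by (intro sum.cong) auto

lemma bmean_add: "bmean q V (\<lambda>S. f S + g S) = bmean q V f + bmean q V g"
  by (simp add: bmean_def distrib_left sum.distrib)

lemma bmean_diff: "bmean q V (\<lambda>S. f S - g S) = bmean q V f - bmean q V g"
  by (simp add: bmean_def right_diff_distrib sum_subtractf)

lemma bmean_cmult: "bmean q V (\<lambda>S. c * f S) = c * bmean q V f"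
  by (simp add: bmean_def sum_distrib_left mult_ac)

lemma bmean_const: "finite V \<Longrightarrow> bmean q V (\<lambda>_. c) = c"
  by (induction V rule: finite_induct) (simp_all add: bmean_insert algebra_simps)

lemma bmean_mono:
  assumes "q \<in> {0..1}" "\<And>S. S \<subseteq> V \<Longrightarrow> f S \<le> g S"
  shows "bmean q V f \<le> bmean q V g"
  unfolding bmean_def using assms by (intro sum_mono mult_left_mono) auto

lemma bmean_nonneg:
  assumes "q \<in> {0..1}" "\<And>S. S \<subseteq> V \<Longrightarrow> 0 \<le> f S"
  shows "0 \<le> bmean q V f"
  unfolding bmean_def using assms by (intro sum_nonneg mult_nonneg_nonneg) auto

lemma bmean_Un:
  assumes "finite A" "finite B" "A \<inter> B = {}"
  shows "bmean q (A \<union> B) f = bmean q A (\<lambda>S. bmean q B (\<lambda>T. f (S \<union> T)))"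
  using assms(1,3)
proof (induction A arbitrary: f rule: finite_induct)
  case (insert v A)
  have "bmean q (insert v A \<union> B) f = bmean q (insert v (A \<union> B)) f" by simp
  also have "\<dots> = q * bmean q (A \<union> B) (\<lambda>S. f (insert v S)) + (1 - q) * bmean q (A \<union> B) f"
    using insert assms by (intro bmean_insert) auto
  finally show ?case using insert by (simp add: bmean_insert)
qed simp

lemma bmean_indep:
  assumes "finite V" "A \<subseteq> V" "B \<subseteq> V" "A \<inter> B = {}"
  shows "bmean q V (\<lambda>S. f (S \<inter> A) * g (S \<inter> B)) = bmean q A f * bmean q B g"
proof -
  have fin: "finite A" "finite B" using assms by (auto intro: finite_subset)
  let ?C = "V - (A \<union> B)"
  have V: "V = (A \<union> B) \<union> ?C" using assms by auto
  have "bmean q V (\<lambda>S. f (S \<inter> A) * g (S \<inter> B))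
      = bmean q (A \<union> B) (\<lambda>S. bmean q ?C (\<lambda>T. f ((S \<union> T) \<inter> A) * g ((S \<union> T) \<inter> B)))"
    by (subst V, subst bmean_Un) (use assms fin in auto)
  also have "\<dots> = bmean q (A \<union> B) (\<lambda>S. bmean q ?C (\<lambda>T. f (S \<inter> A) * g (S \<inter> B)))"
  proof (intro bmean_cong)
    fix S T assume "T \<subseteq> ?C"
    then have "(S \<union> T) \<inter> A = S \<inter> A" "(S \<union> T) \<inter> B = S \<inter> B" by auto
    then show "f ((S \<union> T) \<inter> A) * g ((S \<union> T) \<inter> B) = f (S \<inter> A) * g (S \<inter> B)" by simp
  qed
  also have "\<dots> = bmean q (A \<union> B) (\<lambda>S. f (S \<inter> A) * g (S \<inter> B))"
    using assms(1) by (simp add: bmean_const)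
  also have "\<dots> = bmean q A (\<lambda>S. bmean q B (\<lambda>T. f ((S \<union> T) \<inter> A) * g ((S \<union> T) \<inter> B)))"
    using fin assms by (intro bmean_Un)
  also have "\<dots> = bmean q A (\<lambda>S. bmean q B (\<lambda>T. f S * g T))"
  proof (intro bmean_cong)
    fix S T assume "S \<subseteq> A" "T \<subseteq> B"
    then have "(S \<union> T) \<inter> A = S" "(S \<union> T) \<inter> B = T" using assms by auto
    then show "f ((S \<union> T) \<inter> A) * g ((S \<union> T) \<inter> B) = f S * g T" by simp
  qed
  also have "\<dots> = bmean q A f * bmean q B g"
    using bmean_cmult[of q A "bmean q B g" f] by (simp add: bmean_cmult mult.commute)
  finally show ?thesis .
qed

lemma bmean_image:
  assumes "inj_on \<phi> V"
  shows "bmean q (\<phi> ` V) f = bmean q V (\<lambda>S. f (\<phi> ` S))"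
proof -
  have "bmean q (\<phi> ` V) f
      = (\<Sum>S\<in>Pow V. q ^ card (\<phi> ` S) * (1 - q) ^ card (\<phi> ` V - \<phi> ` S) * f (\<phi> ` S))"
    unfolding bmean_def image_Pow_surj[OF refl, symmetric]
    using assms by (subst sum.reindex) (auto intro: inj_on_image_Pow)
  also have "\<dots> = bmean q V (\<lambda>S. f (\<phi> ` S))"
    unfolding bmean_def
  proof (intro sum.cong refl)
    fix S assume "S \<in> Pow V"
    then have "S \<subseteq> V" by simp
    then have "card (\<phi> ` S) = card S" "card (\<phi> ` (V - S)) = card (V - S)"
      using assms by (meson Diff_subset card_image inj_on_subset)+
    moreover have "\<phi> ` (V - S) = \<phi> ` V - \<phi> ` S"
      using \<open>S \<subseteq> V\<close> by (intro inj_on_image_set_diff[OF assms]) auto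
    ultimately have "card (\<phi> ` S) = card S" "card (\<phi> ` V - \<phi> ` S) = card (V - S)"
      by simp_all
    then show "q ^ card (\<phi> ` S) * (1 - q) ^ card (\<phi> ` V - \<phi> ` S) * f (\<phi> ` S)
        = q ^ card S * (1 - q) ^ card (V - S) * f (\<phi> ` S)" by simp
  qed
  finally show ?thesis .
qed

lemma bmean_one: "finite V \<Longrightarrow> bmean 1 V f = f V"
  by (induction V arbitrary: f rule: finite_induct) (simp_all add: bmean_insert)

lemma prob_Pi_pmf_bernoulli:
  assumes "finite V" "q \<in> {0..1}"
  shows "measure_pmf.prob (Pi_pmf V False (\<lambda>_. bernoulli_pmf q)) {\<omega>. P {t \<in> V. \<omega> t}}
       = bmean q V (\<lambda>S. of_bool (P S))"
  using assms(1)
proof (induction V arbitrary: P rule: finite_induct)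
  case empty
  then show ?case by (simp add: indicator_def)
next
  case (insert v V)
  let ?M = "Pi_pmf V False (\<lambda>_. bernoulli_pmf q)"
  have fin: "finite (set_pmf ?M)"
    unfolding set_Pi_pmf[OF insert(1)] by (rule finite_PiE_dflt[OF insert(1)]) simp
  have upd: "{t \<in> insert v V. fun_upd \<omega> v True t} = insert v {t \<in> V. \<omega> t}"
    "{t \<in> insert v V. fun_upd \<omega> v False t} = {t \<in> V. \<omega> t}" for \<omega>
    using insert.hyps by auto
  have bern: "(\<Sum>y\<in>UNIV. pmf (bernoulli_pmf q) y * g y) = q * g True + (1 - q) * g False" for g
    using assms(2) by (simp add: UNIV_bool)
  have "measure_pmf.prob (Pi_pmf (insert v V) False (\<lambda>_. bernoulli_pmf q))
          {\<omega>. P {t \<in> insert v V. \<omega> t}}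
      = measure_pmf.expectation (Pi_pmf (insert v V) False (\<lambda>_. bernoulli_pmf q))
          (indicator {\<omega>. P {t \<in> insert v V. \<omega> t}})" by simp
  also have "\<dots> = (\<Sum>y\<in>UNIV. pmf (bernoulli_pmf q) y * measure_pmf.prob ?M
          {\<omega>. P {t \<in> insert v V. fun_upd \<omega> v y t}})"
    unfolding Pi_pmf_insert'[OF insert(1,2)] map_pmf_def[symmetric]
    by (subst pmf_expectation_bind[where A = UNIV])
       (simp_all only: fin finite_imageI finite set_map_pmf subset_UNIV measure_map_pmf vimage_def
          Bochner_Integration.integral_indicator space_measure_pmf Int_UNIV_right
          real_scaleR_def mem_Collect_eq)
  also have "\<dots> = q * measure_pmf.prob ?M {\<omega>. P {t \<in> insert v V. fun_upd \<omega> v True t}}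
      + (1 - q) * measure_pmf.prob ?M {\<omega>. P {t \<in> insert v V. fun_upd \<omega> v False t}}"
    by (rule bern)
  also have "\<dots> = bmean q (insert v V) (\<lambda>S. of_bool (P S))"
    unfolding upd bmean_insert[OF insert.hyps]
    using insert.IH[of "\<lambda>S. P (insert v S)"] insert.IH[of P] by simp
  finally show ?case .
qed

section \<open>Discrete derivatives and the Margulis--Russo formula\<close>

lemma flip_diff_insert:
  assumes "v \<noteq> j"
  shows "flip_diff f j (insert v S) = flip_diff (\<lambda>S. f (insert v S)) j S"
  using assms by (simp add: flip_diff_def insert_commute insert_Diff_if)

text \<open>Because \<^term>\<open>flip_diff f v\<close> ignores \<open>v\<close>, averaging over \<open>v\<close> changes nothing.\<close>

lemma bmean_flip_diff:
  assumes "finite V" "v \<notin> V"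
  shows "bmean q (insert v V) (\<lambda>S. F (flip_diff f v S)) = bmean q V (\<lambda>S. F (f (insert v S) - f S))"
proof -
  have "flip_diff f v (insert v S) = f (insert v S) - f S"
    "flip_diff f v S = f (insert v S) - f S" if "S \<subseteq> V" for S
  proof -
    have "v \<notin> S" using that assms by blast
    then show "flip_diff f v (insert v S) = f (insert v S) - f S"
      "flip_diff f v S = f (insert v S) - f S" by (simp_all add: flip_diff_def)
  qed
  then have "bmean q V (\<lambda>S. F (flip_diff f v (insert v S))) = bmean q V (\<lambda>S. F (f (insert v S) - f S))"
    "bmean q V (\<lambda>S. F (flip_diff f v S)) = bmean q V (\<lambda>S. F (f (insert v S) - f S))"
    by (intro bmean_cong; simp)+
  then show ?thesis
    unfolding bmean_insert[OF assms] by (simp only: left_diff_distrib)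
qed

lemma bmean_flip_diff_other:
  assumes "finite V" "v \<notin> V" "j \<in> V"
  shows "bmean q (insert v V) (\<lambda>S. F (flip_diff f j S))
    = q * bmean q V (\<lambda>S. F (flip_diff (\<lambda>S. f (insert v S)) j S))
      + (1 - q) * bmean q V (\<lambda>S. F (flip_diff f j S))"
proof -
  have "v \<noteq> j" using assms by auto
  then show ?thesis using assms by (simp add: bmean_insert flip_diff_insert)
qed

text \<open>The derivative of the mean is the total influence. By conditioning on one element the product
  rule yields the influence of that element plus the two conditional total influences.\<close>

lemma russo_formula:
  assumes "finite V"
  shows "((\<lambda>q. bmean q V f) has_real_derivative (\<Sum>v\<in>V. bmean q V (flip_diff f v))) (at q)"
  using assms
proof (induction V arbitrary: f rule: finite_induct)
  case (insert v V)
  let ?f1 = "\<lambda>S. f (insert v S)"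
  let ?d1 = "\<Sum>j\<in>V. bmean q V (flip_diff ?f1 j)" and ?d0 = "\<Sum>j\<in>V. bmean q V (flip_diff f j)"
  have "((\<lambda>q. q * bmean q V ?f1) has_real_derivative q * ?d1 + 1 * bmean q V ?f1) (at q)"
    by (intro DERIV_mult' DERIV_ident insert.IH)
  moreover have "((\<lambda>q. (1 - q) * bmean q V f) has_real_derivative
      (1 - q) * ?d0 + (0 - 1) * bmean q V f) (at q)"
    by (intro DERIV_mult' DERIV_diff DERIV_const DERIV_ident insert.IH)
  ultimately have "((\<lambda>q. q * bmean q V ?f1 + (1 - q) * bmean q V f) has_real_derivative
      (q * ?d1 + 1 * bmean q V ?f1) + ((1 - q) * ?d0 + (0 - 1) * bmean q V f)) (at q)"
    by (rule DERIV_add)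
  moreover have "(\<Sum>j\<in>V. bmean q (insert v V) (flip_diff f j)) = q * ?d1 + (1 - q) * ?d0"
    unfolding sum_distrib_left sum.distrib[symmetric]
    by (intro sum.cong refl bmean_flip_diff_other[OF insert.hyps, where F = "\<lambda>x. x"])
  moreover have "bmean q (insert v V) (flip_diff f v) = bmean q V ?f1 - bmean q V f"
    using bmean_flip_diff[OF insert.hyps, where F = "\<lambda>x. x"] by (simp add: bmean_diff)
  ultimately show ?case
    unfolding sum.insert[OF insert.hyps] bmean_insert[OF insert.hyps, of _ f]
    by (elim DERIV_cong) simp
qed simp

text \<open>A symmetry of \<open>f\<close> preserves influences. It is the link from transitivity of a symmetry
  group to smallness of every single influence.\<close>

lemma bmean_flip_diff_invariant:
  assumes "inj \<sigma>" "\<sigma> ` V = V" and inv: "\<And>S. f (\<sigma> ` S) = f S"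
  shows "bmean q V (flip_diff f (\<sigma> v)) = bmean q V (flip_diff f v)"
proof -
  have "bmean q V (flip_diff f (\<sigma> v)) = bmean q (\<sigma> ` V) (flip_diff f (\<sigma> v))"
    using assms(2) by simp
  also have "\<dots> = bmean q V (\<lambda>S. flip_diff f (\<sigma> v) (\<sigma> ` S))"
    using assms(1) by (intro bmean_image) (auto intro: inj_on_subset)
  also have "\<dots> = bmean q V (flip_diff f v)"
  proof (intro bmean_cong)
    fix S
    have "insert (\<sigma> v) (\<sigma> ` S) = \<sigma> ` insert v S" "\<sigma> ` S - {\<sigma> v} = \<sigma> ` (S - {v})"
      using assms(1) by (simp_all add: image_set_diff)
    then show "flip_diff f (\<sigma> v) (\<sigma> ` S) = flip_diff f v S"
      by (simp only: flip_diff_def inv)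
  qed
  finally show ?thesis .
qed

section \<open>Log-Sobolev inequality and influences\<close>

text \<open>The tangent of \<open>ln\<close> at \<open>m\<close>, multiplied by \<open>t\<close>; at \<open>t = 0\<close> both sides
  vanish.\<close>

lemma mult_ln_le:
  fixes t m :: real
  assumes "0 \<le> t" "0 < m"
  shows "t * ln t \<le> t * ln m + t * (t / m - 1)"
proof (cases "t = 0")
  case False
  then have "ln (t / m) \<le> t / m - 1" using assms by (intro ln_le_minus_one) auto
  then have "t * ln (t / m) \<le> t * (t / m - 1)" using assms by (intro mult_left_mono) auto
  then show ?thesis using assms False by (simp add: ln_div algebra_simps)
qed simp

text \<open>The logarithmic Sobolev inequality on a two-point space. Entropy is at most variance divided by
  mean, which here is \<open>q (1 - q) (x\<^sup>2 - y\<^sup>2)\<^sup>2 / m\<close>, and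
  \<open>q (1 - q) (x + y)\<^sup>2 \<le> m\<close> since the difference is the square of
  \<open>q x - (1 - q) y\<close>. The constant \<open>1\<close> is not the best one, but it is uniform in \<open>q\<close>.\<close>

lemma two_point_entropy:
  fixes q x y :: real
  assumes q: "q \<in> {0..1}" 
  defines "m \<equiv> q * x\<^sup>2 + (1 - q) * y\<^sup>2"
  shows "q * (x\<^sup>2 * ln (x\<^sup>2)) + (1 - q) * (y\<^sup>2 * ln (y\<^sup>2)) - m * ln m \<le> (x - y)\<^sup>2"
proof (cases "m = 0")
  case True
  have "0 \<le> q * x\<^sup>2" "0 \<le> (1 - q) * y\<^sup>2" using q by auto
  then have "q * x\<^sup>2 = 0" "(1 - q) * y\<^sup>2 = 0" using True unfolding m_def by linarith+
  then have "q * (x\<^sup>2 * ln (x\<^sup>2)) = 0" "(1 - q) * (y\<^sup>2 * ln (y\<^sup>2)) = 0"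
    by (metis mult.assoc mult_zero_left)+
  then show ?thesis by (simp only: True) simp
next
  case False
  have "0 \<le> m" using q unfolding m_def by auto
  with False have m: "m > 0" by simp
  have "q * (x\<^sup>2 * ln (x\<^sup>2)) + (1 - q) * (y\<^sup>2 * ln (y\<^sup>2))
     \<le> q * (x\<^sup>2 * ln m + x\<^sup>2 * (x\<^sup>2 / m - 1)) + (1 - q) * (y\<^sup>2 * ln m + y\<^sup>2 * (y\<^sup>2 / m - 1))"
    using q m by (intro add_mono mult_left_mono mult_ln_le) auto
  also have "\<dots> = m * ln m + ((q * x^4 + (1 - q) * y^4) / m - m)"
  proof -
    have "q * (x\<^sup>2 * l + x\<^sup>2 * (x\<^sup>2 * r - 1)) + (1 - q) * (y\<^sup>2 * l + y\<^sup>2 * (y\<^sup>2 * r - 1))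
        = m * l + ((q * x^4 + (1 - q) * y^4) * r - m)" for l r
      unfolding m_def by algebra
    from this[of "ln m" "inverse m"] show ?thesis by (simp add: divide_inverse)
  qed
  also have "(q * x^4 + (1 - q) * y^4) / m - m = (q * x^4 + (1 - q) * y^4 - m\<^sup>2) / m"
    using m by (simp add: field_simps power2_eq_square)
  also have "q * x^4 + (1 - q) * y^4 - m\<^sup>2 = q * (1 - q) * (x + y)\<^sup>2 * (x - y)\<^sup>2"
    unfolding m_def by algebra
  also have "\<dots> \<le> m * (x - y)\<^sup>2"
  proof (intro mult_right_mono)
    have "m - q * (1 - q) * (x + y)\<^sup>2 = (q * x - (1 - q) * y)\<^sup>2" unfolding m_def by algebra
    then show "q * (1 - q) * (x + y)\<^sup>2 \<le> m" by (smt (verit) zero_le_power2)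
  qed simp
  finally show ?thesis using m by (simp add: divide_right_mono)
qed

text \<open>The inequality for finite sums, with the square root of the weight put into each factor.\<close>

lemma bmean_Cauchy_Schwarz:
  assumes "q \<in> {0..1}"
  shows "(bmean q V (\<lambda>S. f S * g S))\<^sup>2 \<le> bmean q V (\<lambda>S. (f S)\<^sup>2) * bmean q V (\<lambda>S. (g S)\<^sup>2)"
proof -
  let ?w = "\<lambda>S. q ^ card S * (1 - q) ^ card (V - S)"
  have w: "?w S * (a * b) = (sqrt (?w S) * a) * (sqrt (?w S) * b)" for S a b
  proof -
    have "sqrt (?w S) * sqrt (?w S) = ?w S"
      using assms by (intro real_sqrt_mult_self[THEN trans] abs_of_nonneg mult_nonneg_nonneg) auto
    moreover have "(s * a) * (s * b) = (s * s) * (a * b)" for s :: real by simp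
    ultimately show ?thesis by simp
  qed
  show ?thesis
    unfolding bmean_def power2_eq_square w
    using Cauchy_Schwarz_ineq_sum[of "\<lambda>S. sqrt (?w S) * f S" "\<lambda>S. sqrt (?w S) * g S" "Pow V"]
    by (simp only: power2_eq_square)
qed

text \<open>Tensorisation. Conditioning on \<open>v\<close> splits the entropy of \<open>h\<^sup>2\<close> into the mean of the two
  conditional entropies, which the induction hypothesis bounds, and the entropy of the two-point
  function with values \<open>m1\<close> and \<open>m0\<close>. The latter is at most
  \<open>(sqrt m1 - sqrt m0)\<^sup>2\<close>, and this is at most the mean square of \<open>flip_diff h v\<close> by
  the Cauchy--Schwarz inequality.\<close>

lemma log_sobolev:
  assumes "finite V" and q: "q \<in> {0..1}"
  shows "bmean q V (\<lambda>S. (h S)\<^sup>2 * ln ((h S)\<^sup>2))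
       - bmean q V (\<lambda>S. (h S)\<^sup>2) * ln (bmean q V (\<lambda>S. (h S)\<^sup>2))
       \<le> (\<Sum>v\<in>V. bmean q V (\<lambda>S. (flip_diff h v S)\<^sup>2))"
  using assms(1)
proof (induction V arbitrary: h rule: finite_induct)
  case (insert v V)
  let ?h1 = "\<lambda>S. h (insert v S)"
  define m1 where "m1 = bmean q V (\<lambda>S. (?h1 S)\<^sup>2)"
  define m0 where "m0 = bmean q V (\<lambda>S. (h S)\<^sup>2)"
  define L1 where "L1 = bmean q V (\<lambda>S. (?h1 S)\<^sup>2 * ln ((?h1 S)\<^sup>2))"
  define L0 where "L0 = bmean q V (\<lambda>S. (h S)\<^sup>2 * ln ((h S)\<^sup>2))"
  define E1 where "E1 = (\<Sum>j\<in>V. bmean q V (\<lambda>S. (flip_diff ?h1 j S)\<^sup>2))"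
  define E0 where "E0 = (\<Sum>j\<in>V. bmean q V (\<lambda>S. (flip_diff h j S)\<^sup>2))"
  have IH: "L1 - m1 * ln m1 \<le> E1" "L0 - m0 * ln m0 \<le> E0"
    unfolding L1_def m1_def E1_def L0_def m0_def E0_def by (rule insert.IH)+
  have nn: "0 \<le> m1" "0 \<le> m0" unfolding m1_def m0_def using q by (auto intro!: bmean_nonneg)
  have E: "(\<Sum>j\<in>insert v V. bmean q (insert v V) (\<lambda>S. (flip_diff h j S)\<^sup>2))
      = bmean q V (\<lambda>S. (?h1 S - h S)\<^sup>2) + (q * E1 + (1 - q) * E0)"
    unfolding E1_def E0_def sum_distrib_left sum.distrib[symmetric]
    using bmean_flip_diff[OF insert.hyps, where F = "\<lambda>x. x\<^sup>2"]
      bmean_flip_diff_other[OF insert.hyps, where F = "\<lambda>x. x\<^sup>2"] insert.hyps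
    by (simp cong: sum.cong)
  have cross: "bmean q V (\<lambda>S. ?h1 S * h S) \<le> sqrt m1 * sqrt m0"
    using bmean_Cauchy_Schwarz[OF q, of V ?h1 h] nn
    unfolding m1_def m0_def by (metis real_le_rsqrt real_sqrt_mult)
  have "bmean q V (\<lambda>S. (?h1 S - h S)\<^sup>2)
      = bmean q V (\<lambda>S. ((?h1 S)\<^sup>2 + (h S)\<^sup>2) - 2 * (?h1 S * h S))"
    by (intro bmean_cong) (simp add: power2_eq_square algebra_simps)
  also have "\<dots> = m1 + m0 - 2 * bmean q V (\<lambda>S. ?h1 S * h S)"
    unfolding bmean_diff bmean_add bmean_cmult m1_def m0_def ..
  finally have "(sqrt m1 - sqrt m0)\<^sup>2 \<le> bmean q V (\<lambda>S. (?h1 S - h S)\<^sup>2)"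
    using cross nn by (simp add: power2_diff)
  moreover have "q * (m1 * ln m1) + (1 - q) * (m0 * ln m0)
      - (q * m1 + (1 - q) * m0) * ln (q * m1 + (1 - q) * m0) \<le> (sqrt m1 - sqrt m0)\<^sup>2"
    using two_point_entropy[OF q, of "sqrt m1" "sqrt m0"] nn by simp
  moreover have "q * (L1 - m1 * ln m1) + (1 - q) * (L0 - m0 * ln m0) \<le> q * E1 + (1 - q) * E0"
    using q IH by (intro add_mono mult_left_mono) auto
  ultimately have "q * L1 + (1 - q) * L0
      - (q * m1 + (1 - q) * m0) * ln (q * m1 + (1 - q) * m0)
      \<le> bmean q V (\<lambda>S. (?h1 S - h S)\<^sup>2) + (q * E1 + (1 - q) * E0)"
    by (simp add: right_diff_distrib)
  then show ?case unfolding E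
    using insert by (simp add: bmean_insert L1_def L0_def m1_def m0_def)
qed simp

text \<open>A function whose mean absolute value is much smaller than its norm in \<open>L\<^sup>2\<close> is
  concentrated on a small set, so that its square has large entropy. The bound \<open>m ln (m / a\<^sup>2)\<close>
  comes from the tangent of \<open>ln\<close> at \<open>m / a\<close>, the typical size of \<open>\<bar>h\<bar>\<close> under the
  density proportional to \<open>h\<^sup>2\<close>; then \<open>m ln (m / a) \<ge> m - a\<close> removes the dependence
  on the size of \<open>m\<close> and leaves a quantity that can be summed over martingale increments.\<close>

lemma entropy_lower:
  fixes h :: "'a set \<Rightarrow> real"
  assumes q: "q \<in> {0..1}" "finite V"
  defines "m \<equiv> bmean q V (\<lambda>S. (h S)\<^sup>2)" and "a \<equiv> bmean q V (\<lambda>S. \<bar>h S\<bar>)"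
  assumes a: "a \<le> \<delta>" "0 < \<delta>"
  shows "m * ln (1 / \<delta>) + m - a \<le> bmean q V (\<lambda>S. (h S)\<^sup>2 * ln ((h S)\<^sup>2)) - m * ln m"
proof (cases "m = 0")
  case True
  have nz: "q ^ card S * (1 - q) ^ card (V - S) * (h S)\<^sup>2 = 0" if "S \<in> Pow V" for S
  proof -
    have "\<forall>S\<in>Pow V. q ^ card S * (1 - q) ^ card (V - S) * (h S)\<^sup>2 = 0"
      using True q unfolding m_def bmean_def
      by (subst (asm) sum_nonneg_eq_0_iff) auto
    then show ?thesis using that by blast
  qed
  have "bmean q V (\<lambda>S. (h S)\<^sup>2 * ln ((h S)\<^sup>2)) = 0"
    unfolding bmean_def using nz by (intro sum.neutral) (auto simp flip: mult.assoc)
  moreover have "0 \<le> a" unfolding a_def using q by (intro bmean_nonneg) auto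
  ultimately show ?thesis using True by simp
next
  case False
  have "0 \<le> m" unfolding m_def using q by (intro bmean_nonneg) auto
  with False have m: "m > 0" by simp
  have "a \<noteq> 0"
  proof
    assume "a = 0"
    then have "\<forall>S\<in>Pow V. q ^ card S * (1 - q) ^ card (V - S) * \<bar>h S\<bar> = 0"
      using q unfolding a_def bmean_def by (subst (asm) sum_nonneg_eq_0_iff) auto
    then have "m = 0" unfolding m_def bmean_def by (intro sum.neutral) auto
    with m show False by simp
  qed
  moreover have "0 \<le> a" unfolding a_def using q by (intro bmean_nonneg) auto
  ultimately have a0: "a > 0" by simp
  define s where "s = m / a"
  have s: "s > 0" using m a0 by (simp add: s_def)
  have pt: "(2 * ln s + 2) * t\<^sup>2 - 2 * s * \<bar>t\<bar> \<le> t\<^sup>2 * ln (t\<^sup>2)" for t :: real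
  proof (cases "t = 0")
    case False
    define r where "r = s / \<bar>t\<bar>"
    have "ln r \<le> r - 1" using s False unfolding r_def by (intro ln_le_minus_one) auto
    then have "2 * ln s + 2 - 2 * r \<le> 2 * ln \<bar>t\<bar>" using s False by (simp add: r_def ln_div)
    also have "2 * ln \<bar>t\<bar> = ln (t\<^sup>2)"
      using ln_realpow[of "\<bar>t\<bar>" 2] False by simp
    finally have "(2 * ln s + 2 - 2 * r) * t\<^sup>2 \<le> ln (t\<^sup>2) * t\<^sup>2" by (intro mult_right_mono) auto
    moreover have "r * t\<^sup>2 = s * \<bar>t\<bar>"
    proof -
      have sq: "t\<^sup>2 = \<bar>t\<bar> * \<bar>t\<bar>" by (simp add: power2_eq_square)
      show ?thesis using False unfolding sq r_def by (simp del: abs_mult_self_eq)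
    qed
    ultimately show ?thesis by (simp add: algebra_simps)
  qed simp
  have "(2 * ln s + 2) * m - 2 * s * a
      = bmean q V (\<lambda>S. (2 * ln s + 2) * (h S)\<^sup>2 - 2 * s * \<bar>h S\<bar>)"
    by (simp add: bmean_diff bmean_cmult m_def a_def)
  also have "\<dots> \<le> bmean q V (\<lambda>S. (h S)\<^sup>2 * ln ((h S)\<^sup>2))"
    using q pt by (intro bmean_mono)
  finally have 1: "2 * m * ln s \<le> bmean q V (\<lambda>S. (h S)\<^sup>2 * ln ((h S)\<^sup>2))"
    using a0 by (simp add: s_def algebra_simps)
  have ls: "ln s = ln m - ln a" using m a0 by (simp add: s_def ln_div)
  have "ln (a / m) \<le> a / m - 1" using m a0 by (intro ln_le_minus_one) auto
  then have "m * ln (a / m) \<le> m * (a / m - 1)" using m by (intro mult_left_mono) auto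
  then have 2: "m * ln a - m * ln m \<le> a - m" using m a0 by (simp add: ln_div algebra_simps)
  have "ln a \<le> ln \<delta>" using a a0 by simp
  then have "m * ln a \<le> m * ln \<delta>" using m by (intro mult_left_mono) auto
  then show ?thesis using 1 2 a unfolding ls by (simp add: ln_div algebra_simps)
qed

text \<open>If all influences are small, the total influence is large compared with the variance. This
  is an inequality of Falik and Samorodnitsky, proved by revealing the elements of \<open>V\<close> one by one.
  Averaging over \<open>v\<close> turns \<open>f\<close> into \<open>g\<close>. This lowers the variance by \<open>w m\<close>, where
  \<open>h\<close> is the discrete derivative in \<open>v\<close>, and it lowers the energy in the other directions by
  exactly \<open>w\<close> times the energy of \<open>h\<close>. The log-Sobolev inequality converts that lost energy into
  entropy of \<open>h\<^sup>2\<close>, and this entropy exceeds \<open>m ln (1 / \<delta>)\<close> up to a term that is linear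
  in the influence of \<open>v\<close>.\<close>

lemma variance_ln_influence_le:
  assumes "finite V" and q: "q \<in> {0..1}" and "0 < \<delta>"
    and "\<And>v. v \<in> V \<Longrightarrow> bmean q V (\<lambda>S. \<bar>flip_diff f v S\<bar>) \<le> \<delta>"
  shows "(bmean q V (\<lambda>S. (f S)\<^sup>2) - (bmean q V f)\<^sup>2) * ln (1 / \<delta>)
     \<le> (\<Sum>v\<in>V. bmean q V (\<lambda>S. (flip_diff f v S)\<^sup>2)) + (\<Sum>v\<in>V. bmean q V (\<lambda>S. \<bar>flip_diff f v S\<bar>))"
  using assms(1,4)
proof (induction V arbitrary: f rule: finite_induct)
  case (insert v V)
  note fin = insert.hyps
  let ?f1 = "\<lambda>S. f (insert v S)"
  define g where "g = (\<lambda>S. q * f (insert v S) + (1 - q) * f S)"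
  define h where "h = (\<lambda>S. f (insert v S) - f S)"
  define w where "w = q * (1 - q)"
  have w: "0 \<le> w" "w \<le> 1" using q by (auto simp: w_def mult_le_one)
  define m where "m = bmean q V (\<lambda>S. (h S)\<^sup>2)"
  define a where "a = bmean q V (\<lambda>S. \<bar>h S\<bar>)"
  have a_nn: "0 \<le> a" and m_nn: "0 \<le> m"
    unfolding a_def m_def using q by (auto intro!: bmean_nonneg)
  have flip_g: "flip_diff g j S = q * flip_diff ?f1 j S + (1 - q) * flip_diff f j S"
    and flip_h: "flip_diff h j S = flip_diff ?f1 j S - flip_diff f j S" for j S
    by (simp_all add: flip_diff_def g_def h_def algebra_simps)
  have abs_g: "bmean q V (\<lambda>S. \<bar>flip_diff g j S\<bar>) \<le> bmean q (insert v V) (\<lambda>S. \<bar>flip_diff f j S\<bar>)"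
    if j: "j \<in> V" for j
  proof -
    have "bmean q V (\<lambda>S. \<bar>flip_diff g j S\<bar>)
        \<le> bmean q V (\<lambda>S. q * \<bar>flip_diff ?f1 j S\<bar> + (1 - q) * \<bar>flip_diff f j S\<bar>)"
      unfolding flip_g using q
      by (intro bmean_mono order_trans[OF abs_triangle_ineq]) (auto simp: abs_mult)
    also have "\<dots> = bmean q (insert v V) (\<lambda>S. \<bar>flip_diff f j S\<bar>)"
      using bmean_flip_diff_other[OF fin j, where F = abs] by (simp add: bmean_add bmean_cmult)
    finally show ?thesis .
  qed
  have sq: "bmean q (insert v V) (\<lambda>S. (flip_diff f j S)\<^sup>2)
      = bmean q V (\<lambda>S. (flip_diff g j S)\<^sup>2) + w * bmean q V (\<lambda>S. (flip_diff h j S)\<^sup>2)"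
    if j: "j \<in> V" for j
  proof -
    have "bmean q (insert v V) (\<lambda>S. (flip_diff f j S)\<^sup>2)
       = bmean q V (\<lambda>S. q * (flip_diff ?f1 j S)\<^sup>2 + (1 - q) * (flip_diff f j S)\<^sup>2)"
      using bmean_flip_diff_other[OF fin j, where F = "\<lambda>x. x\<^sup>2"] by (simp add: bmean_add bmean_cmult)
    also have "\<dots> = bmean q V (\<lambda>S. (flip_diff g j S)\<^sup>2 + w * (flip_diff h j S)\<^sup>2)"
      unfolding flip_g flip_h w_def by (intro bmean_cong) algebra
    finally show ?thesis by (simp add: bmean_add bmean_cmult)
  qed
  have IH: "(bmean q V (\<lambda>S. (g S)\<^sup>2) - (bmean q V g)\<^sup>2) * ln (1 / \<delta>)
     \<le> (\<Sum>j\<in>V. bmean q V (\<lambda>S. (flip_diff g j S)\<^sup>2)) + (\<Sum>j\<in>V. bmean q V (\<lambda>S. \<bar>flip_diff g j S\<bar>))"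
    using insert.prems abs_g by (intro insert.IH) (meson insertI2 order_trans)
  have a_eq: "bmean q (insert v V) (\<lambda>S. \<bar>flip_diff f v S\<bar>) = a"
    using bmean_flip_diff[OF fin, where F = abs] by (simp add: a_def h_def)
  have m_eq: "bmean q (insert v V) (\<lambda>S. (flip_diff f v S)\<^sup>2) = m"
    using bmean_flip_diff[OF fin, where F = "\<lambda>x. x\<^sup>2"] by (simp add: m_def h_def)
  have "a \<le> \<delta>" using insert.prems[of v] a_eq by simp
  then have "m * ln (1 / \<delta>) + m - a \<le> bmean q V (\<lambda>S. (h S)\<^sup>2 * ln ((h S)\<^sup>2)) - m * ln m"
    unfolding m_def a_def using q fin \<open>0 < \<delta>\<close> by (intro entropy_lower)
  also have "\<dots> \<le> (\<Sum>j\<in>V. bmean q V (\<lambda>S. (flip_diff h j S)\<^sup>2))"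
    unfolding m_def using q fin by (intro log_sobolev)
  finally have "w * (m * ln (1 / \<delta>) + m - a) \<le> w * (\<Sum>j\<in>V. bmean q V (\<lambda>S. (flip_diff h j S)\<^sup>2))"
    using w by (intro mult_left_mono)
  moreover have "w * a \<le> a" "0 \<le> w * m" using w a_nn m_nn by (auto intro: mult_left_le_one_le)
  ultimately have step: "w * m * ln (1 / \<delta>)
      \<le> w * (\<Sum>j\<in>V. bmean q V (\<lambda>S. (flip_diff h j S)\<^sup>2)) + a"
    by (simp add: algebra_simps)
  have f_mean: "bmean q (insert v V) f = bmean q V g"
    using fin by (simp add: bmean_insert g_def bmean_add bmean_cmult)
  have "bmean q (insert v V) (\<lambda>S. (f S)\<^sup>2)
      = bmean q V (\<lambda>S. q * (f (insert v S))\<^sup>2 + (1 - q) * (f S)\<^sup>2)"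
    using fin by (simp add: bmean_insert bmean_add bmean_cmult)
  also have "\<dots> = bmean q V (\<lambda>S. (g S)\<^sup>2 + w * (h S)\<^sup>2)"
    unfolding g_def h_def w_def by (intro bmean_cong) algebra
  finally have f_sq: "bmean q (insert v V) (\<lambda>S. (f S)\<^sup>2) = bmean q V (\<lambda>S. (g S)\<^sup>2) + w * m"
    by (simp add: bmean_add bmean_cmult m_def)
  have "(\<Sum>j\<in>V. bmean q V (\<lambda>S. \<bar>flip_diff g j S\<bar>))
      \<le> (\<Sum>j\<in>V. bmean q (insert v V) (\<lambda>S. \<bar>flip_diff f j S\<bar>))"
    using abs_g by (intro sum_mono)
  moreover have "(\<Sum>j\<in>V. bmean q (insert v V) (\<lambda>S. (flip_diff f j S)\<^sup>2))
     = (\<Sum>j\<in>V. bmean q V (\<lambda>S. (flip_diff g j S)\<^sup>2)) + w * (\<Sum>j\<in>V. bmean q V (\<lambda>S. (flip_diff h j S)\<^sup>2))"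
    using sq by (simp add: sum.distrib sum_distrib_left)
  moreover have "((bmean q V (\<lambda>S. (g S)\<^sup>2) + w * m) - (bmean q V g)\<^sup>2) * ln (1 / \<delta>)
     = (bmean q V (\<lambda>S. (g S)\<^sup>2) - (bmean q V g)\<^sup>2) * ln (1 / \<delta>) + w * m * ln (1 / \<delta>)"
    by (simp only: left_diff_distrib distrib_right)
  ultimately show ?case
    using IH step m_nn unfolding f_mean f_sq sum.insert[OF fin] a_eq m_eq by linarith
qed simp

section \<open>Tilings as exact covers of grid cells\<close>

text \<open>The triple \<open>(i, a, b)\<close> stands for the tile \<^term>\<open>dyadic_tile i (n - i) a b\<close>.\<close>

definition tile_index :: "nat \<Rightarrow> (nat \<times> nat \<times> nat) set" where
  "tile_index n = (SIGMA i:{..n}. {..<2 ^ i} \<times> {..<2 ^ (n - i)})"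

definition tile_of :: "nat \<Rightarrow> nat \<times> nat \<times> nat \<Rightarrow> (real \<times> real) set" where
  "tile_of n = (\<lambda>(i, a, b). dyadic_tile i (n - i) a b)"

text \<open>The square is divided into \<open>2\<^sup>n \<times> 2\<^sup>n\<close> cells, indexed by integers. A tile of order
  \<open>n\<close> is a union of cells, and the tile of a given shape that contains a cell is read off from the
  leading binary digits of the indices of the cell.\<close>

definition covers :: "nat \<Rightarrow> nat \<Rightarrow> nat \<Rightarrow> nat \<times> nat \<times> nat \<Rightarrow> bool" where
  "covers n x y = (\<lambda>(i, a, b). x div 2 ^ (n - i) = a \<and> y div 2 ^ i = b)"

definition exact_cover :: "nat \<Rightarrow> (nat \<times> nat \<times> nat) set \<Rightarrow> bool" where
  "exact_cover n U \<longleftrightarrow> U \<subseteq> tile_index n \<and> (\<forall>x<2 ^ n. \<forall>y<2 ^ n. \<exists>!t. t \<in> U \<and> covers n x y t)"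

definition tileable :: "nat \<Rightarrow> (nat \<times> nat \<times> nat) set \<Rightarrow> bool" where
  "tileable n S \<longleftrightarrow> (\<exists>U\<subseteq>S. exact_cover n U)"

lemma finite_tile_index [simp]: "finite (tile_index n)"
  by (simp add: tile_index_def)

lemma dyadic_tiles_eq: "dyadic_tiles n = tile_of n ` tile_index n"
  by (simp add: dyadic_tiles_eq_image tile_of_def tile_index_def)

lemma inj_tile_of: "inj_on (tile_of n) (tile_index n)"
  by (auto simp: inj_on_def tile_of_def dest: dyadic_tile_inject)

lemma dyadic_interval_cell:
  fixes u :: real
  assumes "k \<le> n" "real x \<le> u * 2 ^ n" "u * 2 ^ n \<le> real x + 1"
    and "x div 2 ^ (n - k) = a"
  shows "real a / 2 ^ k \<le> u" "u \<le> (real a + 1) / 2 ^ k"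
proof -
  let ?N = "2 ^ (n - k) :: nat"
  define R where "R = real ?N"
  have R: "R > 0" "(2::real) ^ n = 2 ^ k * R"
    using assms(1) by (simp_all add: R_def flip: power_add)
  have "a * ?N \<le> x" "x + 1 \<le> (a + 1) * ?N"
    using assms(4) by (auto simp: Suc_le_eq dividend_less_div_times)
  then have "real (a * ?N) \<le> real x" "real (x + 1) \<le> real ((a + 1) * ?N)"
    by (simp_all only: of_nat_le_iff)
  then have "real a * R \<le> real x" "real x + 1 \<le> (real a + 1) * R"
    by (simp_all only: of_nat_mult of_nat_add of_nat_1 R_def)
  then have "real a * R \<le> (u * 2 ^ k) * R" "(u * 2 ^ k) * R \<le> (real a + 1) * R"
    using assms(2,3) unfolding R(2) by (simp_all only: mult.assoc)
  then have "real a \<le> u * 2 ^ k" "u * 2 ^ k \<le> real a + 1"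
    using R(1) by (simp_all only: mult_le_cancel_right_pos)
  then show "real a / 2 ^ k \<le> u" "u \<le> (real a + 1) / 2 ^ k"
    by (simp_all add: field_simps)
qed

text \<open>The centre of a cell lies strictly inside a dyadic interval or outside it. Testing at centres
  therefore cannot be disturbed by boundaries, and it identifies closed tiles with their interiors.\<close>

lemma dyadic_interval_center:
  fixes x n :: nat
  defines "c \<equiv> (real x + 1 / 2) / 2 ^ n"
  assumes k: "k \<le> n"
  shows "x div 2 ^ (n - k) = a \<Longrightarrow> c \<in> {real a / 2 ^ k <..< (real a + 1) / 2 ^ k}"
    and "c \<in> {real a / 2 ^ k .. (real a + 1) / 2 ^ k} \<Longrightarrow> x div 2 ^ (n - k) = a"
proof -
  let ?N = "2 ^ (n - k) :: nat"
  have pow: "(2::real) ^ n = 2 ^ k * real ?N"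
    using k by (simp flip: power_add)
  have quot: "b / K \<le> z / (K * R) \<longleftrightarrow> b * R \<le> z" "b / K < z / (K * R) \<longleftrightarrow> b * R < z"
    "z / (K * R) \<le> b / K \<longleftrightarrow> z \<le> b * R" "z / (K * R) < b / K \<longleftrightarrow> z < b * R"
    if "K > 0" "R > 0" for K R b z :: real
    using that by (simp_all add: field_simps)
  have l: "real a / 2 ^ k \<le> c \<longleftrightarrow> real (a * ?N) \<le> real x + 1 / 2"
    "real a / 2 ^ k < c \<longleftrightarrow> real (a * ?N) < real x + 1 / 2"
    "c \<le> (real a + 1) / 2 ^ k \<longleftrightarrow> real x + 1 / 2 \<le> real ((a + 1) * ?N)"
    "c < (real a + 1) / 2 ^ k \<longleftrightarrow> real x + 1 / 2 < real ((a + 1) * ?N)"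
    using quot[where K = "2 ^ k" and R = "real ?N" and b = "real a" and z = "real x + 1 / 2"]
      quot[where K = "2 ^ k" and R = "real ?N" and b = "real a + 1" and z = "real x + 1 / 2"]
    unfolding c_def pow by (simp_all only: of_nat_mult of_nat_add of_nat_1) simp_all
  have half: "real m \<le> real x + 1 / 2 \<longleftrightarrow> m \<le> x" "real m < real x + 1 / 2 \<longleftrightarrow> m \<le> x"
    "real x + 1 / 2 \<le> real m \<longleftrightarrow> x < m" "real x + 1 / 2 < real m \<longleftrightarrow> x < m" for m
    by linarith+
  have iff: "x div ?N = a \<longleftrightarrow> a * ?N \<le> x \<and> x < (a + 1) * ?N"
    by (auto simp: dividend_less_times_div intro!: div_nat_eqI simp: mult.commute)
  show "x div 2 ^ (n - k) = a \<Longrightarrow> c \<in> {real a / 2 ^ k <..< (real a + 1) / 2 ^ k}"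
    "c \<in> {real a / 2 ^ k .. (real a + 1) / 2 ^ k} \<Longrightarrow> x div 2 ^ (n - k) = a"
    unfolding greaterThanLessThan_iff atLeastAtMost_iff l half iff by auto
qed

text \<open>Every interior point of a dyadic interval of level at most \<open>n\<close> lies in a cell of level \<open>n\<close>
  inside that interval. The cell is chosen independently of the interval, so overlapping interiors
  share a cell.\<close>

lemma dyadic_interval_interior_cell:
  fixes u :: real
  assumes k: "k \<le> n" and a: "real a / 2 ^ k < u" "u < (real a + 1) / 2 ^ k"
  shows "nat \<lfloor>u * 2 ^ n\<rfloor> div 2 ^ (n - k) = a"
proof -
  let ?N = "2 ^ (n - k) :: nat" and ?x = "nat \<lfloor>u * 2 ^ n\<rfloor>"
  have pow: "(2::real) ^ n = 2 ^ k * real ?N"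
    using k by (simp flip: power_add)
  have u: "0 \<le> u" using a(1) by (smt (verit) divide_nonneg_nonneg of_nat_0_le_iff zero_le_power)
  have "real a \<le> u * 2 ^ k" "u * 2 ^ k < real a + 1"
    using a by (auto simp: field_simps)
  then have "real a * real ?N \<le> (u * 2 ^ k) * real ?N" "(u * 2 ^ k) * real ?N < (real a + 1) * real ?N"
    by (simp_all only: mult_right_mono of_nat_0_le_iff) (simp add: mult_strict_right_mono)
  then have "real (a * ?N) \<le> u * 2 ^ n" "u * 2 ^ n < real ((a + 1) * ?N)"
    unfolding pow by (simp_all only: of_nat_mult of_nat_add of_nat_1 mult.assoc)
  moreover have "real ?x \<le> u * 2 ^ n" using u by simp
  ultimately have "a * ?N \<le> ?x" "real ?x < real ((a + 1) * ?N)"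
    by (auto intro: le_nat_floor)
  then have "a * ?N \<le> ?x" "?x < (a + 1) * ?N"
    by (simp_all only: of_nat_less_iff)
  then show ?thesis by (intro div_nat_eqI) (simp_all add: mult.commute)
qed

lemma interior_tile_of:
  "interior (tile_of n (i, a, b)) = {real a / 2 ^ i <..< (real a + 1) / 2 ^ i}
     \<times> {real b / 2 ^ (n - i) <..< (real b + 1) / 2 ^ (n - i)}"
  by (simp add: tile_of_def dyadic_tile_def interior_Times interior_atLeastAtMost_real)

definition cell_center :: "nat \<Rightarrow> nat \<Rightarrow> nat \<Rightarrow> real \<times> real" where
  "cell_center n x y = ((real x + 1 / 2) / 2 ^ n, (real y + 1 / 2) / 2 ^ n)"

lemma cell_center_covers:
  assumes "t \<in> tile_index n"
  shows "covers n x y t \<Longrightarrow> cell_center n x y \<in> interior (tile_of n t)"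
    and "cell_center n x y \<in> tile_of n t \<Longrightarrow> covers n x y t"
proof -
  obtain i a b where t: "t = (i, a, b)" "i \<le> n" "n - i \<le> n" "n - (n - i) = i"
    using assms by (cases t) (auto simp: tile_index_def)
  show "covers n x y t \<Longrightarrow> cell_center n x y \<in> interior (tile_of n t)"
    using dyadic_interval_center(1)[OF t(2), of x a] dyadic_interval_center(1)[OF t(3), of y b] t(4)
    by (auto simp: t(1) covers_def cell_center_def interior_tile_of)
  show "cell_center n x y \<in> tile_of n t \<Longrightarrow> covers n x y t"
    using dyadic_interval_center(2)[OF t(2), of x a] dyadic_interval_center(2)[OF t(3), of y b] t(4)
    by (auto simp: t(1) covers_def cell_center_def tile_of_def dyadic_tile_def)
qed

lemma tile_of_subset_unit_square:
  assumes "t \<in> tile_index n"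
  shows "tile_of n t \<subseteq> unit_square"
proof -
  have *: "{real a / 2 ^ i .. (real a + 1) / 2 ^ i} \<subseteq> {0..1}" if "a < 2 ^ i" for a i :: nat
  proof -
    have "real (a + 1) \<le> real (2 ^ i)" using that by (simp only: of_nat_le_iff)
    then have "(real a + 1) / 2 ^ i \<le> 1" by (simp add: field_simps)
    moreover have "0 \<le> real a / 2 ^ i" by simp
    ultimately show ?thesis by (meson atLeastatMost_subset_iff)
  qed
  obtain i a b where "t = (i, a, b)" "a < 2 ^ i" "b < 2 ^ (n - i)"
    using assms by (cases t) (auto simp: tile_index_def)
  then show ?thesis using *[of a i] *[of b "n - i"]
    unfolding tile_of_def dyadic_tile_def unit_square_def by (simp only: prod.case Sigma_mono)
qed

text \<open>The right end point \<open>1\<close> lies in the last cell; every other point is treated by rounding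
  down.\<close>

lemma unit_interval_cell:
  fixes u :: real
  assumes "u \<in> {0..1}"
  obtains x :: nat where "x < 2 ^ n" "real x \<le> u * 2 ^ n" "u * 2 ^ n \<le> real x + 1"
proof (cases "u = 1")
  case True
  have "real (2 ^ n - 1 :: nat) = 2 ^ n - 1" by (simp add: of_nat_diff)
  then show ?thesis using True by (intro that[of "2 ^ n - 1"]) auto
next
  case False
  have x: "u * 2 ^ n < 2 ^ n" "0 \<le> u * 2 ^ n" using assms False by auto
  show ?thesis
  proof (rule that)
    show l: "real (nat \<lfloor>u * 2 ^ n\<rfloor>) \<le> u * 2 ^ n" using x by simp
    then have "real (nat \<lfloor>u * 2 ^ n\<rfloor>) < 2 ^ n" using x(1) by (rule le_less_trans)
    then have "real (nat \<lfloor>u * 2 ^ n\<rfloor>) < real (2 ^ n)" by simp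
    then show "nat \<lfloor>u * 2 ^ n\<rfloor> < 2 ^ n" by (simp only: of_nat_less_iff)
    show "u * 2 ^ n \<le> real (nat \<lfloor>u * 2 ^ n\<rfloor>) + 1" using x by linarith
  qed
qed

text \<open>Cell centres transfer covering and uniqueness from the geometric tiling to the grid. In the
  other direction every point of the square lies in a cell, and two tiles with overlapping interiors
  share the cell that contains a common interior point.\<close>

lemma is_tiling_iff_exact_cover:
  assumes U: "U \<subseteq> tile_index n"
  shows "is_tiling (tile_of n ` U) unit_square \<longleftrightarrow> exact_cover n U"
proof
  assume til: "is_tiling (tile_of n ` U) unit_square"
  show "exact_cover n U" unfolding exact_cover_def
  proof (intro conjI U allI impI ex_ex1I)
    fix x y :: nat assume xy: "x < 2 ^ n" "y < 2 ^ n"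
    have unit: "(real z + 1 / 2) / 2 ^ n \<in> {0..1}" if "z < 2 ^ n" for z :: nat
    proof -
      have "real (z + 1) \<le> real (2 ^ n)" using that by (simp only: of_nat_le_iff)
      then show ?thesis by (simp add: field_simps)
    qed
    have "cell_center n x y \<in> unit_square"
      using unit xy by (auto simp: cell_center_def unit_square_def)
    then obtain t where "t \<in> U" "cell_center n x y \<in> tile_of n t"
      using til unfolding is_tiling_def by blast
    then show "\<exists>t. t \<in> U \<and> covers n x y t" using cell_center_covers(2) U by blast
  next
    fix x y s t assume "s \<in> U \<and> covers n x y s" "t \<in> U \<and> covers n x y t"
    then have st: "s \<in> U" "t \<in> U"
      and "cell_center n x y \<in> interior (tile_of n s)" "cell_center n x y \<in> interior (tile_of n t)"
      using U cell_center_covers(1) by blast+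
    then have "tile_of n s = tile_of n t"
      using til unfolding is_tiling_def pairwise_def by blast
    then show "s = t" using inj_tile_of U st by (meson inj_onD subsetD)
  qed
next
  assume ex: "exact_cover n U"
  have "\<Union> (tile_of n ` U) = unit_square"
  proof
    show "\<Union> (tile_of n ` U) \<subseteq> unit_square" using tile_of_subset_unit_square U by blast
    show "unit_square \<subseteq> \<Union> (tile_of n ` U)"
    proof
      fix z assume "z \<in> unit_square"
      then obtain u v where z: "z = (u, v)" "u \<in> {0..1}" "v \<in> {0..1}"
        by (auto simp: unit_square_def)
      obtain x where x: "x < 2 ^ n" "real x \<le> u * 2 ^ n" "u * 2 ^ n \<le> real x + 1"
        using unit_interval_cell z(2) .
      obtain y where y: "y < 2 ^ n" "real y \<le> v * 2 ^ n" "v * 2 ^ n \<le> real y + 1"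
        using unit_interval_cell z(3) .
      obtain t where t: "t \<in> U" "covers n x y t" using ex x y unfolding exact_cover_def by blast
      obtain i a b where tt: "t = (i, a, b)" "i \<le> n" "n - i \<le> n" "n - (n - i) = i"
        using t U by (cases t) (auto simp: tile_index_def)
      have "x div 2 ^ (n - i) = a" "y div 2 ^ (n - (n - i)) = b"
        using t(2) tt by (auto simp: covers_def)
      then have "z \<in> tile_of n t"
        using dyadic_interval_cell[OF tt(2) x(2,3)] dyadic_interval_cell[OF tt(3) y(2,3)]
        by (auto simp: z tt(1) tile_of_def dyadic_tile_def)
      with t show "z \<in> \<Union> (tile_of n ` U)" by blast
    qed
  qed
  moreover have "pairwise (\<lambda>s t. interior s \<inter> interior t = {}) (tile_of n ` U)"
  proof (intro pairwiseI)
    fix s' t' assume "s' \<in> tile_of n ` U" "t' \<in> tile_of n ` U" "s' \<noteq> t'"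
    then obtain s t where st: "s \<in> U" "t \<in> U" "s \<noteq> t" "s' = tile_of n s" "t' = tile_of n t" by blast
    show "interior s' \<inter> interior t' = {}"
    proof (rule ccontr)
      assume "interior s' \<inter> interior t' \<noteq> {}"
      then obtain u v where uv: "(u, v) \<in> interior (tile_of n s)" "(u, v) \<in> interior (tile_of n t)"
        using st by auto
      let ?x = "nat \<lfloor>u * 2 ^ n\<rfloor>" and ?y = "nat \<lfloor>v * 2 ^ n\<rfloor>"
      have cov: "covers n ?x ?y r" if r: "r \<in> U" "(u, v) \<in> interior (tile_of n r)" for r
      proof -
        obtain i a b where rr: "r = (i, a, b)" "i \<le> n" "n - i \<le> n" "n - (n - i) = i"
          using r U by (cases r) (auto simp: tile_index_def)
        show ?thesis
          using r(2) dyadic_interval_interior_cell[OF rr(2), of a u]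
            dyadic_interval_interior_cell[OF rr(3), of b v] rr(4)
          by (auto simp: rr(1) covers_def interior_tile_of)
      qed
      have "?x < 2 ^ n \<and> ?y < 2 ^ n"
      proof -
        obtain i a b where ss: "s = (i, a, b)" "i \<le> n" "a < 2 ^ i" "b < 2 ^ (n - i)"
          using st U by (cases s) (auto simp: tile_index_def)
        have "?x div 2 ^ (n - i) < 2 ^ i" "?y div 2 ^ i < 2 ^ (n - i)"
          using cov[OF st(1) uv(1)] ss by (auto simp: covers_def)
        then show ?thesis using ss(2) by (simp add: div_less_iff_less_mult flip: power_add)
      qed
      then show False
        using ex cov[OF st(1) uv(1)] cov[OF st(2) uv(2)] st unfolding exact_cover_def by blast
    qed
  qed
  ultimately show "is_tiling (tile_of n ` U) unit_square" by (simp add: is_tiling_def)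
qed

lemma tileable_iff:
  assumes "S \<subseteq> tile_index n"
  shows "(\<exists>U\<subseteq>tile_of n ` S. is_tiling U unit_square) \<longleftrightarrow> tileable n S"
proof
  assume "\<exists>U\<subseteq>tile_of n ` S. is_tiling U unit_square"
  then obtain U where U: "U \<subseteq> S" "is_tiling (tile_of n ` U) unit_square"
    unfolding subset_image_iff by blast
  then show "tileable n S"
    using is_tiling_iff_exact_cover[of U n] assms unfolding tileable_def by blast
next
  assume "tileable n S"
  then obtain U where "U \<subseteq> S" "exact_cover n U" unfolding tileable_def by blast
  then show "\<exists>U\<subseteq>tile_of n ` S. is_tiling U unit_square"
    using is_tiling_iff_exact_cover[of U n] assms by (intro exI[of _ "tile_of n ` U"]) blast
qed

lemma tileable_mono: "S \<subseteq> S' \<Longrightarrow> tileable n S \<Longrightarrow> tileable n S'"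
  unfolding tileable_def by blast

text \<open>The vertical strips of full height are a tiling.\<close>

lemma tileable_full: "tileable n (tile_index n)"
proof -
  let ?U = "(\<lambda>a. (n, a, 0)) ` {..<2 ^ n}"
  have "exact_cover n ?U" unfolding exact_cover_def
    by (auto simp: tile_index_def covers_def)
  then show ?thesis unfolding tileable_def exact_cover_def by blast
qed

section \<open>Fault lines\<close>

definition transpose_tile :: "nat \<Rightarrow> nat \<times> nat \<times> nat \<Rightarrow> nat \<times> nat \<times> nat" where
  "transpose_tile n = (\<lambda>(i, a, b). (n - i, b, a))"

text \<open>A tile of order \<open>n\<close> is squeezed horizontally by a factor of two and becomes a tile of order
  \<open>Suc n\<close> in the left half, respectively the right half, of the square.\<close>

definition left_half :: "nat \<times> nat \<times> nat \<Rightarrow> nat \<times> nat \<times> nat" where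
  "left_half = (\<lambda>(i, a, b). (Suc i, a, b))"

definition right_half :: "nat \<times> nat \<times> nat \<Rightarrow> nat \<times> nat \<times> nat" where
  "right_half = (\<lambda>(i, a, b). (Suc i, a + 2 ^ i, b))"

lemma transpose_transpose: "t \<in> tile_index n \<Longrightarrow> transpose_tile n (transpose_tile n t) = t"
  by (auto simp: tile_index_def transpose_tile_def)

lemma transpose_in: "t \<in> tile_index n \<Longrightarrow> transpose_tile n t \<in> tile_index n"
  by (auto simp: tile_index_def transpose_tile_def)

lemma transpose_image: "transpose_tile n ` tile_index n = tile_index n"
proof (intro equalityI subsetI)
  fix t assume "t \<in> tile_index n"
  then show "t \<in> transpose_tile n ` tile_index n"
    by (intro image_eqI[of _ _ "transpose_tile n t"]) (simp_all add: transpose_transpose transpose_in)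
qed (auto intro: transpose_in)

lemma inj_transpose: "inj_on (transpose_tile n) (tile_index n)"
  by (rule inj_on_inverseI) (rule transpose_transpose)

lemma covers_transpose:
  "t \<in> tile_index n \<Longrightarrow> covers n x y (transpose_tile n t) \<longleftrightarrow> covers n y x t"
  by (auto simp: tile_index_def transpose_tile_def covers_def)

text \<open>A map of tiles that is induced by some map of cells sends exact covers to exact covers. This
  treats reflections and digit shifts alike.\<close>

lemma exact_cover_image:
  assumes "exact_cover n U" "\<pi> ` U \<subseteq> tile_index n"
    and "\<And>x y. x < 2 ^ n \<Longrightarrow> y < 2 ^ n \<Longrightarrow>
           \<exists>x'<2 ^ n. \<exists>y'<2 ^ n. \<forall>t\<in>tile_index n. covers n x y (\<pi> t) \<longleftrightarrow> covers n x' y' t"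
  shows "exact_cover n (\<pi> ` U)"
  unfolding exact_cover_def
proof (intro conjI assms(2) allI impI)
  fix x y :: nat assume "x < 2 ^ n" "y < 2 ^ n"
  from assms(3)[OF this] obtain x' y' where xy': "x' < 2 ^ n" "y' < 2 ^ n"
      and iff: "\<And>t. t \<in> tile_index n \<Longrightarrow> covers n x y (\<pi> t) \<longleftrightarrow> covers n x' y' t"
    by blast
  have U: "\<And>t. t \<in> U \<Longrightarrow> t \<in> tile_index n" using assms(1) by (auto simp: exact_cover_def)
  have "\<exists>!t. t \<in> U \<and> covers n x' y' t" using assms(1) xy' by (simp add: exact_cover_def)
  then obtain t where t: "t \<in> U" "covers n x' y' t" "\<And>s. s \<in> U \<Longrightarrow> covers n x' y' s \<Longrightarrow> s = t"
    by blast
  show "\<exists>!t. t \<in> \<pi> ` U \<and> covers n x y t"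
  proof (rule ex1I[of _ "\<pi> t"])
    show "\<pi> t \<in> \<pi> ` U \<and> covers n x y (\<pi> t)" using t(1,2) iff[OF U[OF t(1)]] by simp
    fix s assume "s \<in> \<pi> ` U \<and> covers n x y s"
    then obtain r where r: "r \<in> U" "s = \<pi> r" "covers n x y (\<pi> r)" by auto
    then have "r = t" using iff[OF U[OF r(1)]] t(3) by simp
    then show "s = \<pi> t" using r by simp
  qed
qed

lemma exact_cover_transpose: "exact_cover n U \<Longrightarrow> exact_cover n (transpose_tile n ` U)"
proof (rule exact_cover_image)
  show "transpose_tile n ` U \<subseteq> tile_index n" if "exact_cover n U"
    using that transpose_in by (auto simp: exact_cover_def)
  show "\<exists>x'<2 ^ n. \<exists>y'<2 ^ n. \<forall>t\<in>tile_index n.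
      covers n x y (transpose_tile n t) = covers n x' y' t" if "x < 2 ^ n" "y < 2 ^ n" for x y :: nat
    using that covers_transpose by blast
qed

lemma half_in:
  "t \<in> tile_index n \<Longrightarrow> left_half t \<in> tile_index (Suc n)"
  "t \<in> tile_index n \<Longrightarrow> right_half t \<in> tile_index (Suc n)"
  by (auto simp: tile_index_def left_half_def right_half_def)

lemma inj_half: "inj left_half" "inj right_half"
  by (auto simp: inj_def left_half_def right_half_def)

lemma half_disjoint: "left_half ` tile_index n \<inter> right_half ` tile_index n = {}"
  by (auto simp: tile_index_def left_half_def right_half_def)

text \<open>Squeezing keeps the vertical extent of a tile, while the grid of order \<open>Suc n\<close> has twice as
  many rows; hence the row \<open>2 y\<close> represents the row \<open>y\<close> of the coarser grid.\<close>

lemma covers_half: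
  assumes "t \<in> tile_index n"
  shows "covers (Suc n) x (2 * y) (left_half t) \<longleftrightarrow> covers n x y t"
    and "covers (Suc n) (x + 2 ^ n) (2 * y) (right_half t) \<longleftrightarrow> covers n x y t"
proof -
  obtain i a b where t: "t = (i, a, b)" "i \<le> n"
    using assms by (cases t) (auto simp: tile_index_def)
  have "(2::nat) ^ n = 2 ^ i * 2 ^ (n - i)" using t(2) by (simp flip: power_add)
  then have "(x + 2 ^ n) div 2 ^ (n - i) = x div 2 ^ (n - i) + 2 ^ i" by simp
  then show "covers (Suc n) x (2 * y) (left_half t) \<longleftrightarrow> covers n x y t"
    "covers (Suc n) (x + 2 ^ n) (2 * y) (right_half t) \<longleftrightarrow> covers n x y t"
    by (auto simp: t(1) covers_def left_half_def right_half_def)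
qed

lemma covers_left_imp:
  assumes "t \<in> tile_index (Suc n)" "fst t \<noteq> 0" "x < 2 ^ n" "covers (Suc n) x y t"
  obtains s where "s \<in> tile_index n" "t = left_half s"
proof -
  obtain i a b where t: "t = (Suc i, a, b)" "i \<le> n" "b < 2 ^ (n - i)" "a = x div 2 ^ (n - i)"
    using assms by (cases t; cases "fst t") (auto simp: tile_index_def covers_def)
  have "(2::nat) ^ n = 2 ^ i * 2 ^ (n - i)" using t(2) by (simp flip: power_add)
  then have "a < 2 ^ i" using assms(3) t(4) by (simp add: div_less_iff_less_mult)
  then show ?thesis using t by (intro that[of "(i, a, b)"]) (auto simp: tile_index_def left_half_def)
qed

lemma covers_right_imp:
  assumes "t \<in> tile_index (Suc n)" "fst t \<noteq> 0" "covers (Suc n) (x + 2 ^ n) y t"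
  obtains s where "s \<in> tile_index n" "t = right_half s"
proof -
  obtain i a b where t: "t = (Suc i, a, b)" "i \<le> n" "a < 2 ^ Suc i" "b < 2 ^ (n - i)"
      "a = (x + 2 ^ n) div 2 ^ (n - i)"
    using assms by (cases t; cases "fst t") (auto simp: tile_index_def covers_def)
  have "(2::nat) ^ n = 2 ^ i * 2 ^ (n - i)" using t(2) by (simp flip: power_add)
  then have "a = x div 2 ^ (n - i) + 2 ^ i" using t(5) by simp
  then show ?thesis using t
    by (intro that[of "(i, a - 2 ^ i, b)"]) (auto simp: tile_index_def right_half_def)
qed

text \<open>A tile with \<open>i \<noteq> 0\<close> is at most half as wide as the square and so does not cross the vertical
  bisector.\<close>

lemma exact_cover_halves:
  assumes ex: "exact_cover (Suc n) U" and nz: "\<And>t. t \<in> U \<Longrightarrow> fst t \<noteq> 0"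
  shows "exact_cover n {t \<in> tile_index n. left_half t \<in> U}"
    and "exact_cover n {t \<in> tile_index n. right_half t \<in> U}"
proof -
  have U: "U \<subseteq> tile_index (Suc n)" using ex by (simp add: exact_cover_def)
  have ex1: "\<exists>!t. t \<in> U \<and> covers (Suc n) x y t" if "x < 2 * 2 ^ n" "y < 2 * 2 ^ n" for x y
    using ex that by (simp add: exact_cover_def)
  show "exact_cover n {t \<in> tile_index n. left_half t \<in> U}"
    unfolding exact_cover_def
  proof (intro conjI allI impI)
    fix x y :: nat assume xy: "x < 2 ^ n" "y < 2 ^ n"
    then have "\<exists>!t. t \<in> U \<and> covers (Suc n) x (2 * y) t" by (intro ex1) auto
    then obtain t where t: "t \<in> U" "covers (Suc n) x (2 * y) t"
      "\<And>s. s \<in> U \<Longrightarrow> covers (Suc n) x (2 * y) s \<Longrightarrow> s = t"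
      by blast
    obtain s where s: "s \<in> tile_index n" "t = left_half s"
      using covers_left_imp[OF subsetD[OF U t(1)] nz[OF t(1)] xy(1) t(2)] .
    show "\<exists>!t. t \<in> {t \<in> tile_index n. left_half t \<in> U} \<and> covers n x y t"
    proof (intro ex1I[of _ s] conjI CollectI)
      show "s \<in> tile_index n" "left_half s \<in> U" "covers n x y s"
        using s t(1,2) covers_half(1)[OF s(1)] by auto
      fix r assume r: "r \<in> {t \<in> tile_index n. left_half t \<in> U} \<and> covers n x y r"
      then have "left_half r = t" using covers_half(1)[of r n] by (intro t(3)) auto
      then show "r = s" using s(2) injD[OF inj_half(1)] by blast
    qed
  qed auto
  show "exact_cover n {t \<in> tile_index n. right_half t \<in> U}"
    unfolding exact_cover_def
  proof (intro conjI allI impI)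
    fix x y :: nat assume xy: "x < 2 ^ n" "y < 2 ^ n"
    then have "\<exists>!t. t \<in> U \<and> covers (Suc n) (x + 2 ^ n) (2 * y) t" by (intro ex1) auto
    then obtain t where t: "t \<in> U" "covers (Suc n) (x + 2 ^ n) (2 * y) t"
      "\<And>s. s \<in> U \<Longrightarrow> covers (Suc n) (x + 2 ^ n) (2 * y) s \<Longrightarrow> s = t"
      by blast
    obtain s where s: "s \<in> tile_index n" "t = right_half s"
      using covers_right_imp[OF subsetD[OF U t(1)] nz[OF t(1)] t(2)] .
    show "\<exists>!t. t \<in> {t \<in> tile_index n. right_half t \<in> U} \<and> covers n x y t"
    proof (intro ex1I[of _ s] conjI CollectI)
      show "s \<in> tile_index n" "right_half s \<in> U" "covers n x y s"
        using s t(1,2) covers_half(2)[OF s(1)] by auto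
      fix r assume r: "r \<in> {t \<in> tile_index n. right_half t \<in> U} \<and> covers n x y r"
      then have "right_half r = t" using covers_half(2)[of r n] by (intro t(3)) auto
      then show "r = s" using s(2) injD[OF inj_half(2)] by blast
    qed
  qed auto
qed

definition halves_tileable :: "nat \<Rightarrow> (nat \<times> nat \<times> nat) set \<Rightarrow> bool" where
  "halves_tileable n S \<longleftrightarrow> tileable n {t \<in> tile_index n. left_half t \<in> S}
     \<and> tileable n {t \<in> tile_index n. right_half t \<in> S}"

lemma halves_tileableI:
  assumes "exact_cover (Suc n) U" "U \<subseteq> S" "\<And>t. t \<in> U \<Longrightarrow> fst t \<noteq> 0"
  shows "halves_tileable n S"
proof -
  have "{t \<in> tile_index n. left_half t \<in> U} \<subseteq> {t \<in> tile_index n. left_half t \<in> S}"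
    "{t \<in> tile_index n. right_half t \<in> U} \<subseteq> {t \<in> tile_index n. right_half t \<in> S}"
    using assms(2) by auto
  then show ?thesis
    using exact_cover_halves[OF assms(1,3)] unfolding halves_tileable_def tileable_def by blast
qed

text \<open>A tile that crosses the vertical bisector has full width, and a tile that crosses the horizontal
  bisector has full height. Two such tiles would overlap, so a tiling respects at least one of the
  bisectors.\<close>

lemma fault_line:
  assumes S: "S \<subseteq> tile_index (Suc n)" and "tileable (Suc n) S"
  shows "halves_tileable n S \<or> halves_tileable n (transpose_tile (Suc n) ` S)"
proof -
  obtain U where U: "U \<subseteq> S" "exact_cover (Suc n) U" using assms by (auto simp: tileable_def)
  have ind: "U \<subseteq> tile_index (Suc n)" using U S by blast
  show ?thesis
  proof (cases "\<exists>t\<in>U. fst t = 0")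
    case False
    then have nz: "fst t \<noteq> 0" if "t \<in> U" for t using that by auto
    have "halves_tileable n S" using U(2,1) nz by (rule halves_tileableI)
    then show ?thesis ..
  next
    case True
    then obtain a b where "(0, a, b) \<in> U" by auto
    moreover from this have "(0, a, b) \<in> tile_index (Suc n)" using ind by blast
    then have "a = 0" "b < 2 ^ Suc n" by (simp_all add: tile_index_def)
    ultimately have b: "(0, 0, b) \<in> U" "b < 2 ^ Suc n" by simp_all
    have nz: "fst t \<noteq> 0" if "t \<in> transpose_tile (Suc n) ` U" for t
    proof
      assume "fst t = 0"
      obtain i a c where s: "(i, a, c) \<in> U" "t = transpose_tile (Suc n) (i, a, c)"
        using \<open>t \<in> _\<close> by auto
      then have "(i, a, c) \<in> tile_index (Suc n)" using ind by blast
      then have "i = Suc n" "c = 0" "a < 2 ^ Suc n"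
        using s(2) \<open>fst t = 0\<close> by (auto simp: tile_index_def transpose_tile_def)
      with s(1) have a: "(Suc n, a, 0) \<in> U" "a < 2 ^ Suc n" by simp_all
      have cov: "covers (Suc n) a b (0, 0, b)" "covers (Suc n) a b (Suc n, a, 0)"
        using a b by (auto simp: covers_def simp del: power_Suc)
      have "\<exists>!t. t \<in> U \<and> covers (Suc n) a b t"
        using U(2) a(2) b(2) unfolding exact_cover_def by blast
      then have "(0, 0, b) = (Suc n, a, 0::nat)"
        using a(1) b(1) cov by (elim ex1E) metis
      then show False by simp
    qed
    have "halves_tileable n (transpose_tile (Suc n) ` S)"
      using exact_cover_transpose[OF U(2)] image_mono[OF U(1)] nz by (rule halves_tileableI)
    then show ?thesis ..
  qed
qed

section \<open>A symmetry group transitive on the tiles of each shape\<close>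

text \<open>The action on tiles of the map that flips prescribed binary digits of the coordinates of cells:
  those at which \<open>c\<close> has digit one in the horizontal coordinate, and likewise \<open>d\<close> in the vertical
  coordinate. Only the leading digits that determine a tile act on it.\<close>

definition shift_tile :: "nat \<Rightarrow> nat \<Rightarrow> nat \<Rightarrow> nat \<times> nat \<times> nat \<Rightarrow> nat \<times> nat \<times> nat" where
  "shift_tile n c d = (\<lambda>(i, a, b). (i, xor a (c div 2 ^ (n - i)), xor b (d div 2 ^ i)))"

lemma xor_less_pow2:
  fixes a b :: nat
  assumes "a < 2 ^ k" "b < 2 ^ k"
  shows "xor a b < 2 ^ k"
proof -
  have "take_bit k (xor a b) = xor a b"
    using assms by (simp add: take_bit_xor take_bit_nat_eq_self)
  then show ?thesis using take_bit_nat_eq_self_iff[of k "xor a b"] by blast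
qed

lemma xor_div_pow2: "xor a b div 2 ^ k = xor (a div 2 ^ k) (b div 2 ^ k)" for a b :: nat
  using drop_bit_xor[of k a b] by (simp add: drop_bit_eq_div)

lemma xor_cancel: "xor (xor a c) c = a" for a c :: nat
  by (simp add: xor.assoc)

lemma div_pow2_less:
  assumes "c < 2 ^ n" "i \<le> n"
  shows "c div 2 ^ (n - i) < (2::nat) ^ i"
  using assms by (simp add: div_less_iff_less_mult flip: power_add)

lemma shift_in:
  assumes "c < 2 ^ n" "d < 2 ^ n" "t \<in> tile_index n"
  shows "shift_tile n c d t \<in> tile_index n"
  using assms div_pow2_less[OF assms(1)] div_pow2_less[OF assms(2), of "n - fst t"]
  by (auto simp: tile_index_def shift_tile_def intro!: xor_less_pow2)

lemma shift_shift: "shift_tile n c d (shift_tile n c d t) = t"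
  by (auto simp: shift_tile_def xor_cancel split: prod.splits)

lemma inj_shift: "inj (shift_tile n c d)"
  by (rule inj_on_inverseI) (rule shift_shift)

lemma shift_image:
  assumes "c < 2 ^ n" "d < 2 ^ n"
  shows "shift_tile n c d ` tile_index n = tile_index n"
proof (intro equalityI subsetI)
  fix t assume "t \<in> tile_index n"
  then show "t \<in> shift_tile n c d ` tile_index n"
    by (intro image_eqI[of _ _ "shift_tile n c d t"]) (simp_all add: shift_shift shift_in assms)
qed (use shift_in[OF assms] in blast)

lemma covers_shift: "covers n x y (shift_tile n c d t) \<longleftrightarrow> covers n (xor x c) (xor y d) t"
proof -
  have "u = xor a e \<longleftrightarrow> xor u e = a" for u a e :: nat using xor_cancel by auto
  then show ?thesis by (simp add: covers_def shift_tile_def xor_div_pow2 split: prod.splits)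
qed

lemma exact_cover_shift:
  assumes "c < 2 ^ n" "d < 2 ^ n" "exact_cover n U"
  shows "exact_cover n (shift_tile n c d ` U)"
proof (rule exact_cover_image[OF assms(3)])
  show "shift_tile n c d ` U \<subseteq> tile_index n"
    using assms shift_in by (auto simp: exact_cover_def)
  fix x y :: nat assume "x < 2 ^ n" "y < 2 ^ n"
  then show "\<exists>x'<2 ^ n. \<exists>y'<2 ^ n. \<forall>t\<in>tile_index n.
      covers n x y (shift_tile n c d t) = covers n x' y' t"
    using assms covers_shift xor_less_pow2[of x n c] xor_less_pow2[of y n d] by blast
qed

lemma tileable_shift:
  assumes "c < 2 ^ n" "d < 2 ^ n"
  shows "tileable n (shift_tile n c d ` S) \<longleftrightarrow> tileable n S"
proof -
  have imp: "tileable n (shift_tile n c d ` S)" if "tileable n S" for S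
  proof -
    from that obtain U where "U \<subseteq> S" "exact_cover n U" unfolding tileable_def by blast
    then show ?thesis
      using exact_cover_shift[OF assms] unfolding tileable_def by (meson image_mono)
  qed
  have "shift_tile n c d ` shift_tile n c d ` S = S"
    by (simp add: image_image shift_shift)
  then show ?thesis using imp[of S] imp[of "shift_tile n c d ` S"] by auto
qed

text \<open>Flip the digits in which the two positions differ, placed as leading digits.\<close>

lemma shift_transitive:
  assumes "(i, a, b) \<in> tile_index n" "(i, a', b') \<in> tile_index n"
  obtains c d where "c < 2 ^ n" "d < 2 ^ n" "shift_tile n c d (i, a, b) = (i, a', b')"
proof
  have i: "i \<le> n" and lt: "xor a a' < 2 ^ i" "xor b b' < 2 ^ (n - i)"
    using assms by (auto simp: tile_index_def intro!: xor_less_pow2)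
  let ?c = "xor a a' * 2 ^ (n - i)" and ?d = "xor b b' * 2 ^ i"
  have "?c < 2 ^ i * 2 ^ (n - i)" "?d < 2 ^ (n - i) * 2 ^ i" using lt by (auto intro: mult_strict_right_mono)
  then show "?c < 2 ^ n" "?d < 2 ^ n" using i by (simp_all flip: power_add)
  show "shift_tile n ?c ?d (i, a, b) = (i, a', b')"
    by (simp add: shift_tile_def flip: xor.assoc)
qed

section \<open>Decay below one half\<close>

abbreviation tileable_ind :: "nat \<Rightarrow> (nat \<times> nat \<times> nat) set \<Rightarrow> real" where
  "tileable_ind n S \<equiv> of_bool (tileable n S)"

lemma tiling_prob_eq_bmean:
  assumes "p \<in> {0..1}"
  shows "tiling_prob n p = bmean p (tile_index n) (tileable_ind n)"
proof -
  have "tiling_prob n p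
      = bmean p (dyadic_tiles n) (\<lambda>S. of_bool (\<exists>U\<subseteq>S. is_tiling U unit_square))"
    unfolding tiling_prob_def availability_def
    using assms by (intro prob_Pi_pmf_bernoulli finite_dyadic_tiles)
  also have "\<dots> = bmean p (tile_index n)
      (\<lambda>S. of_bool (\<exists>U\<subseteq>tile_of n ` S. is_tiling U unit_square))"
    unfolding dyadic_tiles_eq by (intro bmean_image inj_tile_of)
  also have "\<dots> = bmean p (tile_index n) (tileable_ind n)"
    by (intro bmean_cong) (simp add: tileable_iff)
  finally show ?thesis .
qed

lemma tiling_prob_bounds: "0 \<le> tiling_prob n p" "tiling_prob n p \<le> 1"
  by (simp_all add: tiling_prob_def)

lemma tiling_prob_one: "tiling_prob n 1 = 1"
  by (simp add: tiling_prob_eq_bmean bmean_one tileable_full)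

text \<open>By the fault line property a tiling splits into tilings of two opposite halves. These halves
  involve disjoint sets of tiles and are independent copies of the problem of order \<open>n\<close>. The factor
  two is the union bound over the two directions of the fault line, which are equally likely by
  transposition.\<close>

lemma tiling_prob_Suc_le:
  assumes p: "p \<in> {0..1}"
  shows "tiling_prob (Suc n) p \<le> 2 * (tiling_prob n p)\<^sup>2"
proof -
  let ?V = "tile_index (Suc n)" and ?\<tau> = "transpose_tile (Suc n)"
  let ?L = "left_half ` tile_index n" and ?R = "right_half ` tile_index n"
  let ?h = "\<lambda>S. of_bool (halves_tileable n S) :: real"
  define F G :: "(nat \<times> nat \<times> nat) set \<Rightarrow> real"
    where "F = (\<lambda>S. tileable_ind n {t \<in> tile_index n. left_half t \<in> S})"
      and "G = (\<lambda>S. tileable_ind n {t \<in> tile_index n. right_half t \<in> S})"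
  have "tiling_prob (Suc n) p \<le> bmean p ?V (\<lambda>S. ?h S + ?h (?\<tau> ` S))"
    unfolding tiling_prob_eq_bmean[OF p]
  proof (rule bmean_mono[OF p])
    fix S assume "S \<subseteq> ?V"
    then show "tileable_ind (Suc n) S \<le> ?h S + ?h (?\<tau> ` S)"
      using fault_line[of S n] by auto
  qed
  also have "\<dots> = bmean p ?V ?h + bmean p (?\<tau> ` ?V) ?h"
    by (simp only: bmean_add bmean_image[OF inj_transpose])
  also have "\<dots> = 2 * bmean p ?V ?h" by (simp only: transpose_image)
  also have "bmean p ?V ?h = bmean p ?V (\<lambda>S. F (S \<inter> ?L) * G (S \<inter> ?R))"
  proof (rule bmean_cong)
    fix S
    have "{t \<in> tile_index n. left_half t \<in> S \<inter> ?L} = {t \<in> tile_index n. left_half t \<in> S}"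
      "{t \<in> tile_index n. right_half t \<in> S \<inter> ?R} = {t \<in> tile_index n. right_half t \<in> S}"
      by auto
    then show "?h S = F (S \<inter> ?L) * G (S \<inter> ?R)"
      by (simp only: F_def G_def halves_tileable_def of_bool_conj)
  qed
  also have "\<dots> = bmean p ?L F * bmean p ?R G"
    using half_in half_disjoint by (intro bmean_indep) auto
  also have "bmean p ?L F = tiling_prob n p"
  proof -
    have "bmean p ?L F = bmean p (tile_index n) (\<lambda>S. F (left_half ` S))"
      using inj_half(1) by (intro bmean_image) (auto intro: inj_on_subset)
    also have "\<dots> = bmean p (tile_index n) (tileable_ind n)"
    proof (rule bmean_cong)
      fix S assume "S \<subseteq> tile_index n"
      then have "{t \<in> tile_index n. left_half t \<in> left_half ` S} = S"
        using inj_half(1) by (auto simp: inj_image_mem_iff)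
      then show "F (left_half ` S) = tileable_ind n S" by (simp only: F_def)
    qed
    finally show ?thesis by (simp only: tiling_prob_eq_bmean[OF p])
  qed
  also have "bmean p ?R G = tiling_prob n p"
  proof -
    have "bmean p ?R G = bmean p (tile_index n) (\<lambda>S. G (right_half ` S))"
      using inj_half(2) by (intro bmean_image) (auto intro: inj_on_subset)
    also have "\<dots> = bmean p (tile_index n) (tileable_ind n)"
    proof (rule bmean_cong)
      fix S assume "S \<subseteq> tile_index n"
      then have "{t \<in> tile_index n. right_half t \<in> right_half ` S} = S"
        using inj_half(2) by (auto simp: inj_image_mem_iff)
      then show "G (right_half ` S) = tileable_ind n S" by (simp only: G_def)
    qed
    finally show ?thesis by (simp only: tiling_prob_eq_bmean[OF p])
  qed
  finally show ?thesis by (simp add: power2_eq_square)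
qed

lemma quadratic_recursion_tendsto_0:
  fixes a :: "nat \<Rightarrow> real"
  assumes nonneg: "\<And>n. 0 \<le> a n" and rec: "\<And>n. a (Suc n) \<le> 2 * (a n)\<^sup>2" and N: "a N < 1 / 2"
  shows "a \<longlonglongrightarrow> 0"
proof -
  define r where "r = 2 * a N"
  have r: "0 \<le> r" "r < 1" using nonneg[of N] N by (auto simp: r_def)
  \<comment> \<open>In terms of \<open>2 * a\<close> the recursion is squaring, which contracts below \<open>1\<close>.\<close>
  have bound: "2 * a (k + N) \<le> r ^ Suc k" for k
  proof (induction k)
    case (Suc k)
    have "r ^ Suc k \<le> r" using r by (simp add: mult_left_le power_le_one)
    then have le_r: "2 * a (k + N) \<le> r" using Suc.IH by linarith
    have "2 * a (Suc k + N) \<le> (2 * a (k + N)) * (2 * a (k + N))"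
      using rec[of "k + N"] by (simp add: power2_eq_square)
    also have "\<dots> \<le> r * r ^ Suc k"
      using le_r Suc.IH nonneg[of "k + N"] r by (intro mult_mono) auto
    finally show ?case by simp
  qed (simp add: r_def)
  have "(\<lambda>k. r ^ k) \<longlonglongrightarrow> 0"
    using r by (intro LIMSEQ_power_zero) simp
  then have lim: "(\<lambda>k. r ^ Suc k / 2) \<longlonglongrightarrow> 0"
    by (intro tendsto_divide_zero LIMSEQ_Suc[of "\<lambda>k. r ^ k"])
  have "norm (a (k + N)) \<le> r ^ Suc k / 2" for k
    using bound[of k] nonneg[of "k + N"] by simp
  then have "(\<lambda>k. a (k + N)) \<longlonglongrightarrow> 0"
    by (intro Lim_null_comparison[OF _ lim] always_eventually allI)
  then show ?thesis by (rule LIMSEQ_offset)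
qed

section \<open>Sharp threshold\<close>

text \<open>Tileability is monotone, so its discrete derivative is the indicator of being pivotal.\<close>

lemma flip_diff_tileable: "flip_diff (tileable_ind n) t S \<in> {0, 1}"
proof -
  have "tileable n (S - {t}) \<Longrightarrow> tileable n (insert t S)" by (erule tileable_mono[rotated]) auto
  then show ?thesis by (auto simp: flip_diff_def)
qed

text \<open>The \<open>2\<^sup>n\<close> tiles of the same shape as \<open>t\<close> are images of \<open>t\<close> under symmetries of the problem,
  hence have the same influence.\<close>

lemma tileable_influence_le:
  assumes q: "q \<in> {0..1}" and t: "t \<in> tile_index n"
  shows "2 ^ n * bmean q (tile_index n) (flip_diff (tileable_ind n) t)
    \<le> (\<Sum>s\<in>tile_index n. bmean q (tile_index n) (flip_diff (tileable_ind n) s))"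
proof -
  let ?I = "\<lambda>s. bmean q (tile_index n) (flip_diff (tileable_ind n) s)"
  obtain i a b where iab: "t = (i, a, b)" "i \<le> n" using t by (cases t) (auto simp: tile_index_def)
  let ?A = "{i} \<times> {..<2 ^ i} \<times> {..<2 ^ (n - i)} :: (nat \<times> nat \<times> nat) set"
  have A: "?A \<subseteq> tile_index n" using iab(2) by (auto simp: tile_index_def)
  have eq: "?I s = ?I t" if sA: "s \<in> ?A" for s
  proof -
    obtain a' b' where s: "s = (i, a', b')" using sA by auto
    have mem: "(i, a, b) \<in> tile_index n" "(i, a', b') \<in> tile_index n"
      using t sA A iab(1) s by auto
    obtain c d where cd: "c < 2 ^ n" "d < 2 ^ n" "shift_tile n c d (i, a, b) = (i, a', b')"
      using shift_transitive[OF mem] .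
    have "?I (shift_tile n c d t) = ?I t"
      using inj_shift shift_image[OF cd(1,2)]
      by (rule bmean_flip_diff_invariant) (simp only: tileable_shift[OF cd(1,2)])
    then show ?thesis using cd(3) iab(1) s by simp
  qed
  have "card ?A = 2 ^ n" using iab(2) by (simp add: card_cartesian_product flip: power_add)
  then have "2 ^ n * ?I t = (\<Sum>s\<in>?A. ?I t)" by simp
  also have "\<dots> = (\<Sum>s\<in>?A. ?I s)" using eq by (intro sum.cong) auto
  also have "\<dots> \<le> (\<Sum>s\<in>tile_index n. ?I s)"
  proof (intro sum_mono2 A finite_tile_index bmean_nonneg[OF q])
    show "0 \<le> flip_diff (tileable_ind n) s S" for s S
      using flip_diff_tileable[of n s S] by auto
  qed
  finally show ?thesis .
qed

lemma tiling_prob_mono: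
  assumes "0 \<le> p" "p \<le> p'" "p' \<le> 1"
  shows "tiling_prob n p \<le> tiling_prob n p'"
proof -
  have "bmean p (tile_index n) (tileable_ind n) \<le> bmean p' (tile_index n) (tileable_ind n)"
  proof (rule DERIV_nonneg_imp_nondecreasing[OF assms(2)])
    fix q assume "p \<le> q" "q \<le> p'"
    then have q: "q \<in> {0..1}" using assms by auto
    have "0 \<le> (\<Sum>v\<in>tile_index n. bmean q (tile_index n) (flip_diff (tileable_ind n) v))"
    proof (intro sum_nonneg bmean_nonneg[OF q])
      show "0 \<le> flip_diff (tileable_ind n) s S" for s S
        using flip_diff_tileable[of n s S] by auto
    qed
    then show "\<exists>y. ((\<lambda>q. bmean q (tile_index n) (tileable_ind n)) has_real_derivative y) (at q) \<and> 0 \<le> y"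
      using russo_formula[OF finite_tile_index] by blast
  qed
  then show ?thesis using assms by (simp add: tiling_prob_eq_bmean)
qed

text \<open>The mean value theorem and the Margulis--Russo formula provide a parameter \<open>q\<close> between \<open>p\<close>
  and \<open>p'\<close> with total influence at most \<open>K = 1 / (p' - p)\<close>. Each influence is then at most
  \<open>K / 2\<^sup>n\<close>, and \<open>variance_ln_influence_le\<close> bounds the variance at \<open>q\<close> by a multiple of
  \<open>1 / n\<close>. As the probability at \<open>q\<close> is at least one half, it has to be close to one.\<close>

lemma tiling_prob_sharp_threshold:
  assumes p: "0 \<le> p" "p < p'" "p' \<le> 1" and half: "1 / 2 \<le> tiling_prob n p"
    and n: "1 / (p' - p) < 2 ^ n"
  shows "(1 - tiling_prob n p') * (real n * ln 2 + ln (p' - p)) \<le> 4 / (p' - p)"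
proof -
  let ?V = "tile_index n" and ?f = "tileable_ind n"
  define I where "I = (\<lambda>q. \<Sum>v\<in>?V. bmean q ?V (flip_diff ?f v))"
  define K where "K = 1 / (p' - p)"
  have K: "K > 0" using p by (simp add: K_def)
  have "\<exists>q>p. q < p' \<and> bmean p' ?V ?f - bmean p ?V ?f = (p' - p) * I q"
    by (rule MVT2[OF p(2)]) (simp only: I_def russo_formula finite_tile_index)
  then obtain q where q: "p < q" "q < p'"
    and mvt: "bmean p' ?V ?f - bmean p ?V ?f = (p' - p) * I q"
    by blast
  have q01: "q \<in> {0..1}" and p01: "p \<in> {0..1}" "p' \<in> {0..1}" using p q by auto
  have "(p' - p) * I q \<le> 1"
    using mvt tiling_prob_bounds[of n p] tiling_prob_bounds[of n p']
    unfolding tiling_prob_eq_bmean[OF p01(1)] tiling_prob_eq_bmean[OF p01(2)] by linarith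
  then have I: "I q \<le> K" using p by (simp add: K_def field_simps)
  have abs: "\<bar>flip_diff ?f v S\<bar> = flip_diff ?f v S" "(flip_diff ?f v S)\<^sup>2 = flip_diff ?f v S" for v S
    using flip_diff_tileable[of n v S] by auto
  define \<delta> where "\<delta> = K / 2 ^ n"
  have \<delta>: "0 < \<delta>" using K by (simp add: \<delta>_def)
  have infl: "bmean q ?V (\<lambda>S. \<bar>flip_diff ?f v S\<bar>) \<le> \<delta>" if "v \<in> ?V" for v
  proof -
    have "2 ^ n * bmean q ?V (flip_diff ?f v) \<le> K"
      using tileable_influence_le[OF q01 that] I unfolding I_def by linarith
    then show ?thesis unfolding abs \<delta>_def by (simp add: field_simps)
  qed
  define T where "T = tiling_prob n q"
  have sq: "(?f S)\<^sup>2 = ?f S" for S by simp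
  \<comment> \<open>For an indicator with monotone event, energy and sum of influences both equal the total
    influence, whence the factor two.\<close>
  have "(T - T\<^sup>2) * ln (1 / \<delta>) \<le> 2 * I q"
    using variance_ln_influence_le[OF finite_tile_index q01 \<delta> infl]
    unfolding abs sq T_def tiling_prob_eq_bmean[OF q01] I_def by simp
  then have var: "(T - T\<^sup>2) * ln (1 / \<delta>) \<le> 2 * K" using I by linarith
  have "tiling_prob n p \<le> T" "T \<le> tiling_prob n p'"
    unfolding T_def using p q by (auto intro!: tiling_prob_mono)
  then have T: "1 / 2 \<le> T" "T \<le> tiling_prob n p'" using half by auto
  have "1 / 2 * (1 - tiling_prob n p') \<le> T * (1 - T)"
    using T tiling_prob_bounds[of n p'] by (intro mult_mono) auto
  moreover have L: "ln (1 / \<delta>) = real n * ln 2 + ln (p' - p)"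
    using p by (simp add: \<delta>_def K_def ln_mult ln_realpow)
  moreover have "0 \<le> ln (1 / \<delta>)"
    using n K by (intro ln_ge_zero) (simp add: \<delta>_def K_def[symmetric] field_simps)
  ultimately have "(1 / 2 * (1 - tiling_prob n p')) * ln (1 / \<delta>) \<le> (T * (1 - T)) * ln (1 / \<delta>)"
    by (intro mult_right_mono)
  also have "T * (1 - T) = T - T\<^sup>2" by (simp add: power2_eq_square algebra_simps)
  finally show ?thesis using var unfolding L K_def by simp
qed

lemma tiling_prob_tendsto_1:
  assumes p: "0 \<le> p" "p < p'" "p' \<le> 1" and half: "\<And>n. 1 / 2 \<le> tiling_prob n p"
  shows "(\<lambda>n. tiling_prob n p') \<longlonglongrightarrow> 1"
proof -
  define d where "d = p' - p"
  have d: "d > 0" using p by (simp add: d_def)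
  have lim: "(\<lambda>n. 1 - 4 / d / (real n * ln 2 + ln d)) \<longlonglongrightarrow> 1" using d by real_asymp
  have lower: "\<forall>\<^sub>F n in sequentially. 1 - 4 / d / (real n * ln 2 + ln d) \<le> tiling_prob n p'"
  proof -
    have "\<forall>\<^sub>F n in sequentially. 1 / d < 2 ^ n" using d by real_asymp
    moreover have "\<forall>\<^sub>F n in sequentially. 0 < real n * ln 2 + ln d" using d by real_asymp
    ultimately show ?thesis
    proof eventually_elim
      case (elim n)
      have "(1 - tiling_prob n p') * (real n * ln 2 + ln d) \<le> 4 / d"
        using tiling_prob_sharp_threshold[OF p half] elim(1) by (simp add: d_def)
      then have "1 - tiling_prob n p' \<le> 4 / d / (real n * ln 2 + ln d)"
        using elim(2) by (simp only: pos_le_divide_eq)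
      then show ?case by simp
    qed
  qed
  have upper: "\<forall>\<^sub>F n in sequentially. tiling_prob n p' \<le> 1"
    by (simp add: tiling_prob_bounds)
  show ?thesis by (rule tendsto_sandwich[OF lower upper lim tendsto_const])
qed

section \<open>The dichotomy at the critical probability\<close>

theorem theorem2:
  fixes p :: real
  assumes "p \<in> {0..1}"
  shows "(p < crit_prob \<longrightarrow> (\<lambda>n. tiling_prob n p) \<longlonglongrightarrow> 0) \<and>
         (p > crit_prob \<longrightarrow> (\<lambda>n. tiling_prob n p) \<longlonglongrightarrow> 1)"
proof (intro conjI impI)
  let ?X = "{p \<in> {0..1}. (\<lambda>n. tiling_prob n p) \<longlonglongrightarrow> 1}"
  have one: "1 \<in> ?X" by (simp add: tiling_prob_one)
  have bdd: "bdd_below ?X" by (intro bdd_belowI[of _ 0]) auto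
  {
    assume sub: "p < crit_prob"
    show "(\<lambda>n. tiling_prob n p) \<longlonglongrightarrow> 0"
    proof (rule ccontr)
      assume not_0: "\<not> (\<lambda>n. tiling_prob n p) \<longlonglongrightarrow> 0"
      have half: "1 / 2 \<le> tiling_prob n p" for n
      proof (rule ccontr)
        assume "\<not> 1 / 2 \<le> tiling_prob n p"
        then have "(\<lambda>n. tiling_prob n p) \<longlonglongrightarrow> 0"
          using tiling_prob_bounds(1) tiling_prob_Suc_le[OF assms]
          by (intro quadratic_recursion_tendsto_0[where N = n]) auto
        with not_0 show False ..
      qed
      \<comment> \<open>Any point strictly between \<open>p\<close> and the critical value yields a contradiction.\<close>
      define p' where "p' = (p + crit_prob) / 2"
      have "crit_prob \<le> 1" unfolding crit_prob_def using one bdd by (rule cInf_lower)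
      then have p': "p < p'" "p' < crit_prob" "p' \<le> 1" using sub by (auto simp: p'_def)
      then have "(\<lambda>n. tiling_prob n p') \<longlonglongrightarrow> 1"
        using assms half by (intro tiling_prob_tendsto_1[of p p']) auto
      then have "p' \<in> ?X" using p' assms by auto
      then have "crit_prob \<le> p'" unfolding crit_prob_def using bdd by (rule cInf_lower)
      with p' show False by simp
    qed
  }
  {
    assume "p > crit_prob"
    moreover have "?X \<noteq> {}" using one by blast
    ultimately have "\<exists>p0\<in>?X. p0 < p" unfolding crit_prob_def by (intro cInf_lessD)
    then obtain p0 where p0: "p0 \<in> ?X" "p0 < p" by (elim bexE)
    have lim: "(\<lambda>n. tiling_prob n p0) \<longlonglongrightarrow> 1" using p0 by simp
    have "tiling_prob n p0 \<le> tiling_prob n p" for n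
      using p0 assms by (intro tiling_prob_mono) auto
    then have lower: "\<forall>\<^sub>F n in sequentially. tiling_prob n p0 \<le> tiling_prob n p" by simp
    have upper: "\<forall>\<^sub>F n in sequentially. tiling_prob n p \<le> 1"
      by (simp add: tiling_prob_bounds)
    show "(\<lambda>n. tiling_prob n p) \<longlonglongrightarrow> 1"
      by (rule tendsto_sandwich[OF lower upper lim tendsto_const])
  }
qed

end
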